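(* Let $A^1,\ldots,A^m$ be given $n\times n$ real symmetric matrices and let $b=(b_i)$ be a given nonzero vector in $\mathbb{R}^m$. Let \[ \mathscr{F}=\{X\in\mathcal{S}^n_+ : \mathrm{tr}(XA^i)=b_i \text{ for } i=1,\ldots,m\}. \] Let $\mathcal{U}_0$ be a given $n\times s$ matrix with full column rank, and assume that $\mathscr{F}\subseteq \mathrm{face}(\mathcal{U}_0\mathcal{U}_0^T)$. Let $X^*=\mathcal{U}_0Y^*\mathcal{U}_0^T$ be a matrix in $\mathscr{F}$ such that $\mathrm{rank}\,X^*=r$, where $r\le s-1$. Then exactly one of the following two statements holds. 1. There exists an $X\in\mathscr{F}$ such that $\mathrm{rank}\,X\ge r+1$. 2. There exist nonzero matrices $\Omega^0,\Omega^1,\ldots,\Omega^k$, for some $k\le s-r$, such that: (a) $\Omega^j=\sum_{i=1}^m x^j_iA^i$ for $j=0,1,\ldots,k$, for some scalars $x^j_i$; (b) $\mathcal{U}_j^T\Omega^j\mathcal{U}_j\succeq \mathbf{0}$ for $j=0,1,\ldots,k$; (c) $\mathrm{tr}(X^*\Omega^j)\le 0$ for $j=0,1,\ldots,k$; (d) $\mathrm{rank}(\mathcal{U}_0^T\Omega^0\mathcal{U}_0)+\mathrm{rank}(\mathcal{U}_1^T\Omega^1\mathcal{U}_1)+\cdots+\mathrm{rank}(\mathcal{U}_k^T\Omega^k\mathcal{U}_k)=s-r$; where $\mathcal{U}_1,\ldots,\mathcal{U}_{k+1}$ and $\mathcal{W}_0,\mathcal{W}_1,\ldots,\mathcal{W}_k$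 are full column rank matrices defined as follows: for $i=0,1,\ldots,k$, $\mathscr{R}(\mathcal{W}_i)=\mathscr{N}(\mathcal{U}_i^T\Omega^i\mathcal{U}_i)$ and $\mathcal{U}_{i+1}=\mathcal{U}_i\mathcal{W}_i$.
   Context: $\mathcal{S}^n$ is the space of $n\times n$ real symmetric matrices and $\mathcal{S}^n_+$ the closed convex cone of positive semidefinite matrices in $\mathcal{S}^n$; $A\succeq\mathbf{0}$ means $A$ is symmetric positive semidefinite. $\mathscr{R}(A)$ and $\mathscr{N}(A)$ denote the column space and the null space of a matrix $A$. A subset $F$ of a convex cone $K$ is a face of $K$ if for all $X,Y\in K$ with $X+Y\in F$ one has $X\in F$ and $Y\in F$. For $A\in\mathcal{S}^n_+$, $\mathrm{face}(A)$ denotes the minimal face of $\mathcal{S}^n_+$ containing $A$, i.e. the intersection of all faces of $\mathcal{S}^n_+$ containing $A$; equivalently $\mathrm{face}(A)=\{X\in\mathcal{S}^n_+:\mathscr{N}(A)\subseteq\mathscr{N}(X)\}$. *)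

theory Defs
  imports "Jordan_Normal_Form.DL_Rank" "Jordan_Normal_Form.Matrix_Kernel"
begin

definition mat_trace :: "real mat \<Rightarrow> real" where
  "mat_trace A = (\<Sum>i<dim_row A. A $$ (i, i))"

definition sym_mats :: "nat \<Rightarrow> real mat set" where
  "sym_mats n = {A \<in> carrier_mat n n. transpose_mat A = A}"

definition psd_cone :: "nat \<Rightarrow> real mat set" where
  "psd_cone n = {A \<in> sym_mats n. \<forall>v \<in> carrier_vec n. 0 \<le> v \<bullet> (A *\<^sub>v v)}"

definition mat_rank :: "real mat \<Rightarrow> nat" where
  "mat_rank A = vec_space.rank (dim_row A) A"

definition full_col_rank :: "real mat \<Rightarrow> bool" where
  "full_col_rank A \<longleftrightarrow> mat_rank A = dim_col A"

definition mat_range :: "real mat \<Rightarrow> real vec set" where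
  "mat_range A = vec_space.col_space (dim_row A) A"

definition convex_cone_mats :: "nat \<Rightarrow> real mat set \<Rightarrow> bool" where
  "convex_cone_mats n K \<longleftrightarrow> K \<noteq> {} \<and> K \<subseteq> carrier_mat n n \<and>
     (\<forall>X\<in>K. \<forall>Y\<in>K. X + Y \<in> K) \<and> (\<forall>c\<ge>0. \<forall>X\<in>K. c \<cdot>\<^sub>m X \<in> K)"

(* A face is required to be a convex subcone. Without this, the remaining
   condition also admits order intervals such as {X. X psd and A - X psd}, and the
   smallest set satisfying it that contains A would be that interval, not
   {X psd. N(A) is contained in N(X)}. *)
definition is_face :: "nat \<Rightarrow> real mat set \<Rightarrow> real mat set \<Rightarrow> bool" where
  "is_face n F K \<longleftrightarrow> F \<subseteq> K \<and> convex_cone_mats n F \<and>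
     (\<forall>X\<in>K. \<forall>Y\<in>K. X + Y \<in> F \<longrightarrow> X \<in> F \<and> Y \<in> F)"

definition min_face :: "nat \<Rightarrow> real mat \<Rightarrow> real mat set" where
  "min_face n A = \<Inter> {F. is_face n F (psd_cone n) \<and> A \<in> F}"

(* The index set {1,...,m} is rendered as a finite type 'm, so that vectors in
   R^m are functions from 'm to the reals. *)
definition feasible_set ::
  "nat \<Rightarrow> ('m::finite \<Rightarrow> real mat) \<Rightarrow> ('m \<Rightarrow> real) \<Rightarrow> real mat set" where
  "feasible_set n A b = {X \<in> psd_cone n. \<forall>i. mat_trace (X * A i) = b i}"

(* The sum of the matrices x i * A i, written entrywise because matrices with
   explicit dimensions do not form a type-class monoid. *)
definition mat_lincomb ::
  "nat \<Rightarrow> ('m::finite \<Rightarrow> real) \<Rightarrow> ('m \<Rightarrow> real mat) \<Rightarrow> real mat" where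
  "mat_lincomb n x A = mat n n (\<lambda>(p, q). \<Sum>i\<in>UNIV. x i * A i $$ (p, q))"

definition compress :: "real mat \<Rightarrow> real mat \<Rightarrow> real mat" where
  "compress U M = transpose_mat U * M * U"

end

theory Submission
  imports "HOL-Analysis.Starlike" "HOL-Analysis.Finite_Cartesian_Product" Defs
begin

text \<open>
  Suppose that every feasible matrix has the form \<open>U Y U\<^sup>T\<close> with \<open>Y\<close> positive semidefinite of order
  \<open>d > r\<close>, and that no feasible matrix has rank above \<open>r\<close>. Then no positive definite \<open>Y\<close> is feasible, so
  separating a point from a convex set in \<open>\<real>\<^sup>m\<close> yields a combination \<open>\<Omega>\<close> of the \<open>A\<^sup>i\<close> such that
  \<open>U\<^sup>T \<Omega> U\<close> is nonzero, positive semidefinite and has nonpositive inner product with \<open>X\<^sup>*\<close>. The value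
  \<open>tr (X \<Omega>)\<close> is the same for all feasible \<open>X\<close>, and \<open>tr (Y C) \<le> 0\<close> for positive semidefinite \<open>Y\<close>
  and \<open>C\<close> forces \<open>C Y = 0\<close>. Hence every feasible \<open>X\<close> factors through \<open>U W\<close>, where the columns of \<open>W\<close>
  span the kernel of \<open>U\<^sup>T \<Omega> U\<close>, and \<open>d\<close> drops by the rank of \<open>U\<^sup>T \<Omega> U\<close>. Iterating until \<open>d = r\<close> gives
  the second statement. Conversely, the same factorisation along a given chain bounds the rank of every
  feasible matrix by the number \<open>r\<close> of columns of the last matrix.
\<close>

unbundle no vec_syntax

section \<open>Rank and kernel\<close>

lemma mat_range_eq: "mat_range A = (*\<^sub>v) A ` carrier_vec (dim_col A)"
proof -
  interpret vec_space "TYPE(real)" "dim_row A" .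
  show ?thesis
    unfolding mat_range_def by (subst col_space_eq[of A "dim_col A"]) (auto intro!: mult_mat_vec_carrier)
qed

lemma mat_rank_eq_dim_range:
  assumes "A \<in> carrier_mat n m"
  shows "mat_rank A = vectorspace.dim class_ring (module_vec TYPE(real) n\<lparr>carrier := mat_range A\<rparr>)"
  using assms unfolding mat_rank_def mat_range_def vec_space.rank_def vec_space.col_space_def by simp

text \<open>Rank-nullity for the linear map given by \<open>A\<close>: its image is
  \<open>mat_range A\<close> and its kernel is \<open>mat_kernel A\<close>.\<close>

lemma mat_rank_nullity:
  assumes A: "A \<in> carrier_mat n m"
  shows "mat_rank A + kernel.dim m A = m"
proof -
  interpret N: vec_space "TYPE(real)" n .
  interpret M: vec_space "TYPE(real)" m .
  interpret L: linear_map class_ring "module_vec TYPE(real) m" "module_vec TYPE(real) n" "\<lambda>v. A *\<^sub>v v"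
    using A
    by (unfold_locales)
      (auto simp: LinearCombinations.module_hom_def module_vec_simps mult_add_distrib_mat_vec mult_mat_vec)
  have im: "L.im = mat_range A"
    using A unfolding L.im_def mat_range_eq by (simp add: module_vec_simps)
  have ker: "L.ker = mat_kernel A"
    using A unfolding L.ker_def by (auto simp: module_vec_simps mat_kernel)
  have "vectorspace.dim class_ring (module_vec TYPE(real) n\<lparr>carrier := L.im\<rparr>)
      + vectorspace.dim class_ring (module_vec TYPE(real) m\<lparr>carrier := L.ker\<rparr>) = M.dim"
    using L.rank_nullity M.fin_dim by simp
  then show ?thesis
    unfolding im ker mat_rank_eq_dim_range[OF A] M.dim_is_n .
qed

text \<open>Dimension is monotone under inclusion of subspaces. The two matrices may have different
  numbers of columns.\<close>

lemma mat_rank_le_range_subset: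
  assumes A: "A \<in> carrier_mat n m" and B: "B \<in> carrier_mat n k"
    and sub: "mat_range A \<subseteq> mat_range B"
  shows "mat_rank A \<le> mat_rank B"
proof -
  interpret N: vec_space "TYPE(real)" n .
  have a: "mat_range A = N.span (set (cols A))" and b: "mat_range B = N.span (set (cols B))"
    using A B unfolding mat_range_def N.col_space_def[symmetric] by auto
  have sA: "subspace class_ring (mat_range A) N.V" and sB: "subspace class_ring (mat_range B) N.V"
    unfolding a b using A B by (metis N.span_is_subspace carrier_matD(1) cols_dim)+
  have "subspace class_ring (mat_range A) (N.vs (mat_range B))"
    by (rule N.nested_subspaces[OF sB sA sub])
  from vectorspace.subspace_dim[OF N.subspace_is_vs[OF sB] this]
  have "vectorspace.dim class_ring (N.vs (mat_range A)) \<le> vectorspace.dim class_ring (N.vs (mat_range B))"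
    using N.fin_dim_span_cols[OF A] N.fin_dim_span_cols[OF B] unfolding a b by simp
  then show ?thesis
    using A B by (simp add: mat_rank_eq_dim_range)
qed

lemma mat_rank_mult_le:
  assumes "A \<in> carrier_mat n m" "B \<in> carrier_mat m k"
  shows "mat_rank (A * B) \<le> mat_rank A"
proof (rule mat_rank_le_range_subset)
  show "mat_range (A * B) \<subseteq> mat_range A"
    using assms by (auto simp: mat_range_eq)
qed (use assms in auto)

lemma mat_rank_le_dim_col: "mat_rank A \<le> dim_col A"
  unfolding mat_rank_def by (rule vec_space.rank_le_nc) auto

text \<open>By rank-nullity, full column rank means that a basis of the kernel is empty. A basis
  omits the zero vector, so over a trivial kernel it has no elements.\<close>

lemma full_col_rank_iff_kernel:
  assumes A: "A \<in> carrier_mat n m"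
  shows "full_col_rank A \<longleftrightarrow> mat_kernel A = {0\<^sub>v m}"
proof -
  interpret K: kernel n m A by unfold_locales (rule A)
  obtain B where B: "finite B" "K.basis B" using kernel_basis_exists[OF A] by blast
  have dim: "K.dim = card B" using K.Ker.dim_basis B by blast
  have e: "K.Ker.span {} = {0\<^sub>v m}" using K.Ker.span_empty by simp
  have "card B = 0 \<longleftrightarrow> mat_kernel A = {0\<^sub>v m}"
  proof
    assume "card B = 0"
    then have "B = {}" using B by simp
    then show "mat_kernel A = {0\<^sub>v m}" using B e unfolding K.Ker.basis_def by simp
  next
    assume k: "mat_kernel A = {0\<^sub>v m}"
    have "0\<^sub>v m \<notin> B"
      using B K.Ker.zero_nin_lin_indpt[of B] unfolding K.Ker.basis_def by auto
    moreover have "B \<subseteq> mat_kernel A" using B unfolding K.Ker.basis_def by simp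
    ultimately have "B = {}" using k by auto
    then show "card B = 0" by simp
  qed
  then show ?thesis
    using mat_rank_nullity[OF A] A dim unfolding full_col_rank_def by auto
qed

lemma full_col_rankI:
  assumes "A \<in> carrier_mat n m" "\<And>v. v \<in> carrier_vec m \<Longrightarrow> A *\<^sub>v v = 0\<^sub>v n \<Longrightarrow> v = 0\<^sub>v m"
  shows "full_col_rank A"
  unfolding full_col_rank_iff_kernel[OF assms(1)] using assms by (auto simp: mat_kernel)

lemma full_col_rankD:
  assumes "full_col_rank A" "A \<in> carrier_mat n m" "v \<in> carrier_vec m" "A *\<^sub>v v = 0\<^sub>v n"
  shows "v = 0\<^sub>v m"
  using assms full_col_rank_iff_kernel[OF assms(2)] mat_kernelI[of A n m v] by auto

lemma full_col_rank_mult: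
  assumes "full_col_rank A" "full_col_rank B" "A \<in> carrier_mat n m" "B \<in> carrier_mat m k"
  shows "full_col_rank (A * B)"
proof (rule full_col_rankI)
  show "A * B \<in> carrier_mat n k" using assms by simp
  fix v assume v: "v \<in> carrier_vec k" "A * B *\<^sub>v v = 0\<^sub>v n"
  then have "A *\<^sub>v (B *\<^sub>v v) = 0\<^sub>v n" using assms by simp
  from full_col_rankD[OF assms(1,3) _ this] have "B *\<^sub>v v = 0\<^sub>v m" using assms v by simp
  from full_col_rankD[OF assms(2,4) v(1) this] show "v = 0\<^sub>v k" .
qed

text \<open>The number of columns of \<open>W\<close> is the nullity of \<open>C\<close>. This
  measures how far the order drops in one reduction step.\<close>

lemma kernel_matrix_dim_col:
  assumes C: "C \<in> carrier_mat n m" and W: "dim_row W = m" "full_col_rank W" "mat_range W = mat_kernel C"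
  shows "mat_rank C + dim_col W = m"
proof -
  have W': "W \<in> carrier_mat m (dim_col W)" using W by auto
  have "dim_col W = mat_rank W" using W unfolding full_col_rank_def by simp
  also have "\<dots> = kernel.dim m C"
    unfolding mat_rank_eq_dim_range[OF W'] W(3) ..
  finally show ?thesis using mat_rank_nullity[OF C] by simp
qed

text \<open>The columns of \<open>W\<close> are a basis of the kernel. Independence and span inside
  the kernel agree with those in the whole space, which gives full column rank and the
  range.\<close>

lemma kernel_matrix_exists:
  assumes C: "C \<in> carrier_mat n m"
  obtains W where "dim_row W = m" "full_col_rank W" "mat_range W = mat_kernel C"
proof -
  interpret K: kernel n m C by unfold_locales (rule C)
  obtain B where B: "finite B" "K.basis B" using kernel_basis_exists[OF C] by blast
  then have BK: "B \<subseteq> mat_kernel C" and li: "K.lin_indpt B" and sp: "K.span B = mat_kernel C"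
    unfolding K.Ker.basis_def by auto
  have Bc: "B \<subseteq> carrier_vec m" using BK mat_kernel_carrier[OF C] by blast
  obtain bs where bs: "set bs = B" "distinct bs" using finite_distinct_list[OF B(1)] by blast
  let ?W = "mat_of_cols m bs"
  have cols: "cols ?W = bs" using bs Bc by simp
  have "\<not> K.NC.lin_dep B" using li K.lindep_same[OF BK] by simp
  then have "vec_space.rank m ?W = length bs"
    using bs by (intro K.NC.lin_indpt_full_rank) (auto simp: cols)
  then have "full_col_rank ?W" unfolding full_col_rank_def mat_rank_def by simp
  moreover have "mat_range ?W = mat_kernel C"
    unfolding mat_range_def K.NC.col_space_def using sp K.span_same[OF BK] by (simp add: cols bs K.NC.col_space_def)
  ultimately show ?thesis using that[of ?W] by simp
qed

text \<open>A column with a nonzero entry, taken as a matrix with a single column, has rank 1, and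
  its range lies in that of \<open>A\<close>.\<close>

lemma mat_rank_pos:
  assumes A: "A \<in> carrier_mat n m" and nz: "A \<noteq> 0\<^sub>m n m"
  shows "0 < mat_rank A"
proof -
  obtain i j where ij: "i < n" "j < m" "A $$ (i, j) \<noteq> 0"
    using nz A by (metis eq_matI carrier_matD index_zero_mat)
  let ?B = "mat n 1 (\<lambda>(i, _). A $$ (i, j))"
  have Bv: "?B *\<^sub>v v = v $ 0 \<cdot>\<^sub>v (A *\<^sub>v unit_vec m j)" if "v \<in> carrier_vec 1" for v
    using that A ij by (intro eq_vecI) (auto simp: scalar_prod_def[of _ v])
  have "full_col_rank ?B"
  proof (rule full_col_rankI)
    fix v :: "real vec" assume v: "v \<in> carrier_vec 1" "?B *\<^sub>v v = 0\<^sub>v n"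
    have "A $$ (i, j) * v $ 0 = (?B *\<^sub>v v) $ i"
      using ij v(1) by (simp add: scalar_prod_def)
    also have "\<dots> = 0" unfolding v(2) using ij by simp
    finally have "v $ 0 = 0" using ij by simp
    then show "v = 0\<^sub>v 1" using v by auto
  qed simp
  then have "mat_rank ?B = 1" unfolding full_col_rank_def by simp
  moreover have "mat_rank ?B \<le> mat_rank A"
  proof (rule mat_rank_le_range_subset)
    show "mat_range ?B \<subseteq> mat_range A"
    proof
      fix y assume "y \<in> mat_range ?B"
      then obtain v where v: "v \<in> carrier_vec 1" "y = ?B *\<^sub>v v" by (auto simp: mat_range_eq)
      have "y = A *\<^sub>v (v $ 0 \<cdot>\<^sub>v unit_vec m j)"
        unfolding v(2) Bv[OF v(1)] using mult_mat_vec[OF A] ij by simp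
      then show "y \<in> mat_range A" using A by (auto simp: mat_range_eq)
    qed
  qed (use A in auto)
  ultimately show ?thesis by simp
qed

section \<open>Gram matrices and left inverses\<close>

lemma scalar_prod_self_eq_0:
  fixes v :: "real vec"
  assumes "v \<in> carrier_vec n"
  shows "v \<bullet> v = 0 \<longleftrightarrow> v = 0\<^sub>v n"
  using assms by (auto simp: scalar_prod_def sum_nonneg_eq_0_iff)

lemma scalar_prod_self_nonneg: "0 \<le> v \<bullet> (v :: real vec)"
  by (auto simp: scalar_prod_def intro: sum_nonneg)

text \<open>The Gram matrix \<open>U\<^sup>T * U\<close> is invertible, since a vector in its kernel
  satisfies \<open>(U *\<^sub>v v) \<bullet> (U *\<^sub>v v) = 0\<close>. Its inverse times
  \<open>U\<^sup>T\<close> is a left inverse of \<open>U\<close>.\<close>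

lemma full_col_rank_left_inverse:
  assumes U: "U \<in> carrier_mat n m" and fr: "full_col_rank U"
  obtains V where "V \<in> carrier_mat m n" "V * U = 1\<^sub>m m"
proof -
  let ?G = "U\<^sup>T * U"
  have G: "?G \<in> carrier_mat m m" using U by simp
  have "det ?G \<noteq> 0"
  proof
    assume "det ?G = 0"
    then obtain v where v: "v \<in> carrier_vec m" "v \<noteq> 0\<^sub>v m" "?G *\<^sub>v v = 0\<^sub>v m"
      using det_0_iff_vec_prod_zero_field[OF G] by blast
    have "(U *\<^sub>v v) \<bullet> (U *\<^sub>v v) = (U\<^sup>T *\<^sub>v (U *\<^sub>v v)) \<bullet> v"
      using transpose_vec_mult_scalar[OF U v(1), of "U *\<^sub>v v"] U v(1) by simp
    also have "\<dots> = 0" using v U by simp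
    finally have "U *\<^sub>v v = 0\<^sub>v n"
      using scalar_prod_self_eq_0[of "U *\<^sub>v v" n] mult_mat_vec_carrier[OF U v(1)] by simp
    then show False using full_col_rankD[OF fr U v(1)] v(2) by simp
  qed
  from det_non_zero_imp_unit[OF G this, of "()"]
  obtain H where "H \<in> carrier_mat m m" "H * ?G = 1\<^sub>m m"
    by (auto simp: Units_def ring_mat_def)
  then show ?thesis using that[of "H * U\<^sup>T"] U by simp
qed

section \<open>Positive semidefinite matrices and faces\<close>

lemma psd_cone_carrier: "A \<in> psd_cone n \<Longrightarrow> A \<in> carrier_mat n n"
  by (simp add: psd_cone_def sym_mats_def)

lemma psd_cone_transpose: "A \<in> psd_cone n \<Longrightarrow> A\<^sup>T = A"
  by (simp add: psd_cone_def sym_mats_def)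

lemma psd_cone_nonneg: "A \<in> psd_cone n \<Longrightarrow> v \<in> carrier_vec n \<Longrightarrow> 0 \<le> v \<bullet> (A *\<^sub>v v)"
  by (simp add: psd_cone_def)

lemma sym_mats_index:
  assumes "A \<in> sym_mats n" "i < n" "j < n"
  shows "A $$ (i, j) = A $$ (j, i)"
proof -
  have A: "A \<in> carrier_mat n n" "A\<^sup>T = A" using assms by (auto simp: sym_mats_def)
  have "A $$ (i, j) = A\<^sup>T $$ (i, j)" using A(2) by simp
  also have "\<dots> = A $$ (j, i)" using A(1) assms by simp
  finally show ?thesis .
qed

lemma psd_cone_sym: "A \<in> psd_cone n \<Longrightarrow> A \<in> sym_mats n"
  by (simp add: psd_cone_def)

lemma sym_mats_scalar_prod:
  assumes A: "A \<in> sym_mats n" and v: "v \<in> carrier_vec n" and w: "w \<in> carrier_vec n"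
  shows "v \<bullet> (A *\<^sub>v w) = w \<bullet> (A *\<^sub>v v)"
proof -
  have A': "A \<in> carrier_mat n n" "A\<^sup>T = A" using A by (auto simp: sym_mats_def)
  have "v \<bullet> (A *\<^sub>v w) = (A *\<^sub>v v) \<bullet> w"
    using transpose_vec_mult_scalar[OF A'(1) w v] A'(2) by simp
  also have "\<dots> = w \<bullet> (A *\<^sub>v v)"
    using A' v w by (intro comm_scalar_prod[of _ n]) auto
  finally show ?thesis .
qed

text \<open>A quadratic polynomial in \<open>t\<close>. Suitable values of \<open>t\<close> yield
  the kernel criterion for positive semidefinite matrices and the subtraction of a rank one
  matrix.\<close>

lemma quadratic_form_add_smult:
  assumes A: "A \<in> sym_mats n" and v: "v \<in> carrier_vec n" and w: "w \<in> carrier_vec n"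
  shows "(v + t \<cdot>\<^sub>v w) \<bullet> (A *\<^sub>v (v + t \<cdot>\<^sub>v w))
    = v \<bullet> (A *\<^sub>v v) + 2 * t * (w \<bullet> (A *\<^sub>v v)) + t\<^sup>2 * (w \<bullet> (A *\<^sub>v w))"
proof -
  have A': "A \<in> carrier_mat n n" using A by (simp add: sym_mats_def)
  have "A *\<^sub>v (v + t \<cdot>\<^sub>v w) = A *\<^sub>v v + t \<cdot>\<^sub>v (A *\<^sub>v w)"
    using A' v w by (simp add: mult_add_distrib_mat_vec mult_mat_vec)
  then show ?thesis
    using A' v w sym_mats_scalar_prod[OF A v w]
    by (simp add: add_scalar_prod_distrib[of _ n] scalar_prod_add_distrib[of _ n]
        algebra_simps power2_eq_square)
qed

text \<open>Moving from \<open>v\<close> in direction \<open>- A *\<^sub>v v\<close> would make the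
  quadratic form negative to first order unless \<open>A *\<^sub>v v\<close> is zero.\<close>

lemma psd_cone_kernelI:
  assumes A: "A \<in> psd_cone n" and v: "v \<in> carrier_vec n" and le: "v \<bullet> (A *\<^sub>v v) \<le> 0"
  shows "A *\<^sub>v v = 0\<^sub>v n"
proof -
  let ?w = "A *\<^sub>v v"
  have w: "?w \<in> carrier_vec n" using psd_cone_carrier[OF A] v by auto
  define a c where "a = ?w \<bullet> ?w" and "c = ?w \<bullet> (A *\<^sub>v ?w)"
  have c: "0 \<le> c" unfolding c_def by (rule psd_cone_nonneg[OF A w])
  have v0: "v \<bullet> (A *\<^sub>v v) = 0" using le psd_cone_nonneg[OF A v] by simp
  \<comment> \<open>The summand 1 keeps the denominator positive when \<open>c = 0\<close>. With
    this step size the form equals \<open>- a\<^sup>2 * (c + 2) / (c + 1)\<^sup>2\<close>, so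
    nonnegativity forces \<open>a = 0\<close>.\<close>
  let ?t = "- a / (c + 1)"
  have "0 \<le> (v + ?t \<cdot>\<^sub>v ?w) \<bullet> (A *\<^sub>v (v + ?t \<cdot>\<^sub>v ?w))"
    using v w by (intro psd_cone_nonneg[OF A]) auto
  also have "\<dots> = 2 * ?t * a + ?t\<^sup>2 * c"
    using v0 unfolding quadratic_form_add_smult[OF psd_cone_sym[OF A] v w] a_def c_def by simp
  also have "\<dots> = - a\<^sup>2 * (c + 2) / (c + 1)\<^sup>2"
    using c by (simp add: divide_simps power2_eq_square) (simp add: algebra_simps)
  finally have "a\<^sup>2 * (c + 2) \<le> 0"
    using c by (simp add: divide_simps split: if_splits)
  then have "a = 0" using c by (smt (verit) mult_pos_pos zero_less_power2)
  then show ?thesis using scalar_prod_self_eq_0[OF w] unfolding a_def by simp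
qed

lemma psd_coneI:
  assumes "A \<in> carrier_mat n n" "A\<^sup>T = A" "\<And>v. v \<in> carrier_vec n \<Longrightarrow> 0 \<le> v \<bullet> (A *\<^sub>v v)"
  shows "A \<in> psd_cone n"
  using assms by (auto simp: psd_cone_def sym_mats_def)

lemma psd_cone_zero: "0\<^sub>m n n \<in> psd_cone n"
proof (rule psd_coneI)
  fix v :: "real vec" assume "v \<in> carrier_vec n"
  moreover have "0\<^sub>m n n *\<^sub>v v = 0\<^sub>v n" using calculation by (intro eq_vecI) auto
  ultimately show "0 \<le> v \<bullet> (0\<^sub>m n n *\<^sub>v v)" by simp
qed auto

lemma psd_cone_one: "1\<^sub>m n \<in> psd_cone n"
  by (rule psd_coneI) (auto simp: scalar_prod_self_nonneg)

lemma psd_cone_add: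
  assumes A: "A \<in> psd_cone n" and B: "B \<in> psd_cone n"
  shows "A + B \<in> psd_cone n"
proof (rule psd_coneI)
  have AB: "A \<in> carrier_mat n n" "B \<in> carrier_mat n n" using A B by (auto dest: psd_cone_carrier)
  then show "A + B \<in> carrier_mat n n" by simp
  show "(A + B)\<^sup>T = A + B"
    using AB psd_cone_transpose[OF A] psd_cone_transpose[OF B] by (simp add: transpose_add)
  fix v :: "real vec" assume v: "v \<in> carrier_vec n"
  then show "0 \<le> v \<bullet> ((A + B) *\<^sub>v v)"
    using AB psd_cone_nonneg[OF A v] psd_cone_nonneg[OF B v]
    by (simp add: add_mult_distrib_mat_vec[of _ n n] scalar_prod_add_distrib[of _ n])
qed

lemma smult_mult_mat_vec:
  assumes "A \<in> carrier_mat n m" "v \<in> carrier_vec m"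
  shows "(c \<cdot>\<^sub>m A) *\<^sub>v v = c \<cdot>\<^sub>v (A *\<^sub>v (v :: real vec))"
  using assms by (intro eq_vecI) auto

lemma psd_cone_smult:
  assumes A: "A \<in> psd_cone n" and c: "0 \<le> c"
  shows "c \<cdot>\<^sub>m A \<in> psd_cone n"
proof (rule psd_coneI)
  have A': "A \<in> carrier_mat n n" using A by (rule psd_cone_carrier)
  then show "c \<cdot>\<^sub>m A \<in> carrier_mat n n" by simp
  show "(c \<cdot>\<^sub>m A)\<^sup>T = c \<cdot>\<^sub>m A"
    using A' by (intro eq_matI) (auto intro: arg_cong[of _ _ "(*) c"] sym_mats_index[OF psd_cone_sym[OF A]])
  fix v :: "real vec" assume v: "v \<in> carrier_vec n"
  then show "0 \<le> v \<bullet> ((c \<cdot>\<^sub>m A) *\<^sub>v v)"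
    using A' psd_cone_nonneg[OF A v] c by (simp add: smult_mult_mat_vec)
qed

lemma sym_mats_congruence:
  assumes Y: "Y \<in> sym_mats s" and U: "U \<in> carrier_mat n s"
  shows "U * Y * U\<^sup>T \<in> sym_mats n"
proof -
  have Y': "Y \<in> carrier_mat s s" "Y\<^sup>T = Y" using Y by (auto simp: sym_mats_def)
  have "(U * Y * U\<^sup>T)\<^sup>T = (U\<^sup>T)\<^sup>T * (U * Y)\<^sup>T"
    using Y' U by (intro transpose_mult) auto
  also have "\<dots> = U * (Y\<^sup>T * U\<^sup>T)" using Y' U by (simp add: transpose_mult)
  also have "\<dots> = U * Y * U\<^sup>T" using Y' U by (simp add: assoc_mult_mat)
  finally show ?thesis using Y' U by (simp add: sym_mats_def)
qed

lemma congruence_quadratic_form: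
  fixes U Y :: "real mat"
  assumes Y: "Y \<in> carrier_mat s s" and U: "U \<in> carrier_mat n s" and v: "v \<in> carrier_vec n"
  shows "v \<bullet> ((U * Y * U\<^sup>T) *\<^sub>v v) = (U\<^sup>T *\<^sub>v v) \<bullet> (Y *\<^sub>v (U\<^sup>T *\<^sub>v v))"
proof -
  let ?w = "Y *\<^sub>v (U\<^sup>T *\<^sub>v v)"
  have "(U * Y * U\<^sup>T) *\<^sub>v v = U *\<^sub>v ?w"
    using Y U v by (simp add: assoc_mult_mat_vec[of _ n s] assoc_mult_mat_vec[of _ n s _ n])
  then show ?thesis
    using transpose_vec_mult_scalar[OF U, of ?w v] Y U v by simp
qed

lemma psd_cone_congruence:
  assumes Y: "Y \<in> psd_cone s" and U: "U \<in> carrier_mat n s"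
  shows "U * Y * U\<^sup>T \<in> psd_cone n"
  using sym_mats_congruence[OF psd_cone_sym[OF Y] U] psd_cone_nonneg[OF Y]
    congruence_quadratic_form[OF psd_cone_carrier[OF Y] U] U
  by (simp add: psd_cone_def)

text \<open>With a left inverse \<open>V\<close> of \<open>U\<close>, the matrix
  \<open>?P = U * V\<close> is a projection onto the range of \<open>U\<close>. The kernel condition
  gives \<open>X * ?P\<^sup>T = X\<close>, transposing gives \<open>?P * X = X\<close>, and together
  \<open>X = U * (V * X * V\<^sup>T) * U\<^sup>T\<close>.\<close>

lemma psd_cone_factor_through:
  assumes X: "X \<in> psd_cone n" and U: "U \<in> carrier_mat n s" and fr: "full_col_rank U"
    and ker: "\<And>v. v \<in> carrier_vec n \<Longrightarrow> U\<^sup>T *\<^sub>v v = 0\<^sub>v s \<Longrightarrow> X *\<^sub>v v = 0\<^sub>v n"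
  obtains Y where "Y \<in> psd_cone s" "X = U * Y * U\<^sup>T"
proof -
  obtain V where V: "V \<in> carrier_mat s n" "V * U = 1\<^sub>m s"
    using full_col_rank_left_inverse[OF U fr] .
  note X' = psd_cone_carrier[OF X]
  let ?P = "U * V"
  have UVT: "U\<^sup>T * (V\<^sup>T * U\<^sup>T) = U\<^sup>T"
  proof -
    have "U\<^sup>T * (V\<^sup>T * U\<^sup>T) = (V * U)\<^sup>T * U\<^sup>T"
      using U V(1) by (simp add: transpose_mult assoc_mult_mat[of _ s n])
    then show ?thesis using U V by simp
  qed
  have XP: "X * (V\<^sup>T * U\<^sup>T) = X"
  proof (rule eq_matI)
    fix i j assume ij: "i < dim_row X" "j < dim_col X"
    let ?e = "unit_vec n j"
    \<comment> \<open>This vector is annihilated by \<open>U\<^sup>T\<close> because of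
      \<open>UVT\<close>, so \<open>ker\<close> applies to it; it compares the columns with index
      \<open>j\<close> of both sides.\<close>
    let ?v = "?e - (V\<^sup>T * U\<^sup>T) *\<^sub>v ?e"
    have v: "?v \<in> carrier_vec n" using U V by simp
    have "U\<^sup>T *\<^sub>v ?v = U\<^sup>T *\<^sub>v ?e - U\<^sup>T *\<^sub>v ((V\<^sup>T * U\<^sup>T) *\<^sub>v ?e)"
      using U V by (intro mult_minus_distrib_mat_vec[of _ s n]) auto
    also have "U\<^sup>T *\<^sub>v ((V\<^sup>T * U\<^sup>T) *\<^sub>v ?e) = U\<^sup>T *\<^sub>v ?e"
      using U V UVT by (metis assoc_mult_mat_vec mult_carrier_mat transpose_carrier_mat unit_vec_carrier)
    finally have "U\<^sup>T *\<^sub>v ?v = 0\<^sub>v s" using U by simp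
    from ker[OF v this] have "0\<^sub>v n = X *\<^sub>v ?v" ..
    also have "\<dots> = X *\<^sub>v ?e - X *\<^sub>v ((V\<^sup>T * U\<^sup>T) *\<^sub>v ?e)"
      using U V X' by (intro mult_minus_distrib_mat_vec[of _ n n]) auto
    also have "X *\<^sub>v ((V\<^sup>T * U\<^sup>T) *\<^sub>v ?e) = (X * (V\<^sup>T * U\<^sup>T)) *\<^sub>v ?e"
      using U V X' by (intro assoc_mult_mat_vec[symmetric]) auto
    finally have "(X *\<^sub>v ?e) $ i - ((X * (V\<^sup>T * U\<^sup>T)) *\<^sub>v ?e) $ i = 0"
      using ij X' U V by (metis carrier_matD(1) dim_mult_mat_vec index_minus_vec(1) index_mult_mat(2) index_zero_vec(1))
    then show "(X * (V\<^sup>T * U\<^sup>T)) $$ (i, j) = X $$ (i, j)"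
      using ij X' U V by (simp del: index_mult_mat(1) add: row_def)
  qed (use X' U in auto)
  have "X = ?P * X"
  proof -
    have "X = (X * (V\<^sup>T * U\<^sup>T))\<^sup>T" using XP psd_cone_transpose[OF X] by simp
    also have "\<dots> = (V\<^sup>T * U\<^sup>T)\<^sup>T * X\<^sup>T" using U V X' by (intro transpose_mult) auto
    also have "\<dots> = ?P * X"
      using U V by (simp add: transpose_mult psd_cone_transpose[OF X])
    finally show ?thesis .
  qed
  then have "X = ?P * (X * (V\<^sup>T * U\<^sup>T))" using XP by simp
  also have "\<dots> = U * (V * (X * (V\<^sup>T * U\<^sup>T)))"
    using U V X' by (intro assoc_mult_mat[of _ n s _ n _ n]) auto
  also have "V * (X * (V\<^sup>T * U\<^sup>T)) = V * X * V\<^sup>T * U\<^sup>T"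
    using U V X' by (simp add: assoc_mult_mat[of _ s n _ n] assoc_mult_mat[of _ s n _ s _ n])
  also have "U * (V * X * V\<^sup>T * U\<^sup>T) = U * (V * X * V\<^sup>T) * U\<^sup>T"
    using U V X' by (intro assoc_mult_mat[symmetric, of _ n s _ s _ n]) auto
  finally have "X = U * (V * X * V\<^sup>T) * U\<^sup>T" .
  moreover have "V * X * V\<^sup>T \<in> psd_cone s" by (rule psd_cone_congruence[OF X V(1)])
  ultimately show ?thesis by (rule that[rotated])
qed

text \<open>The matrices \<open>U * Y * U\<^sup>T\<close> with \<open>Y\<close> positive
  semidefinite form a face. Taking the identity for \<open>Y\<close> shows that it contains
  \<open>U * U\<^sup>T\<close>, so it contains the minimal face, which is an intersection.\<close>

lemma min_face_factor:
  assumes U: "U \<in> carrier_mat n s" and fr: "full_col_rank U"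
    and X: "X \<in> min_face n (U * U\<^sup>T)"
  obtains Y where "Y \<in> psd_cone s" "X = U * Y * U\<^sup>T"
proof -
  let ?F = "{U * Y * U\<^sup>T |Y. Y \<in> psd_cone s}"
  have "is_face n ?F (psd_cone n)"
    unfolding is_face_def convex_cone_mats_def
  proof (intro conjI ballI allI impI)
    show sub: "?F \<subseteq> psd_cone n" using psd_cone_congruence[OF _ U] by auto
    then show "?F \<subseteq> carrier_mat n n" using psd_cone_carrier by blast
    show "?F \<noteq> {}" using psd_cone_zero[of s] by auto
    show "A + B \<in> ?F" if AB: "A \<in> ?F" "B \<in> ?F" for A B
    proof -
      obtain Y Z where YZ: "Y \<in> psd_cone s" "A = U * Y * U\<^sup>T" "Z \<in> psd_cone s" "B = U * Z * U\<^sup>T"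
        using AB by auto
      have "A + B = U * (Y + Z) * U\<^sup>T"
        using YZ(2,4) psd_cone_carrier[OF YZ(1)] psd_cone_carrier[OF YZ(3)] U
        by (simp add: mult_add_distrib_mat[of _ n s] add_mult_distrib_mat[of _ n s])
      then show ?thesis using psd_cone_add[OF YZ(1,3)] by auto
    qed
    show "c \<cdot>\<^sub>m A \<in> ?F" if c: "0 \<le> c" and A: "A \<in> ?F" for c A
    proof -
      obtain Y where Y: "Y \<in> psd_cone s" "A = U * Y * U\<^sup>T" using A by auto
      have "c \<cdot>\<^sub>m A = U * (c \<cdot>\<^sub>m Y) * U\<^sup>T"
        using Y(2) psd_cone_carrier[OF Y(1)] U
        by (simp add: mult_smult_distrib[of _ n s] mult_smult_assoc_mat[of _ n s])
      then show ?thesis using psd_cone_smult[OF Y(1) c] by auto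
    qed
    \<comment> \<open>On the kernel of \<open>U\<^sup>T\<close> the quadratic forms of
      \<open>A\<close> and \<open>B\<close> are nonnegative with sum zero. Hence \<open>A\<close>
      vanishes there and factors through \<open>U\<close>. Commutativity of addition then covers
      \<open>B\<close>.\<close>
    have key: "A \<in> ?F" if A: "A \<in> psd_cone n" and B: "B \<in> psd_cone n" and AB: "A + B \<in> ?F" for A B
    proof -
      obtain Z where Z: "Z \<in> psd_cone s" "A + B = U * Z * U\<^sup>T" using AB by auto
      note car = psd_cone_carrier[OF A] psd_cone_carrier[OF B] psd_cone_carrier[OF Z(1)]
      obtain Y where "Y \<in> psd_cone s" "A = U * Y * U\<^sup>T"
      proof (rule psd_cone_factor_through[OF A U fr])
        fix v :: "real vec" assume v: "v \<in> carrier_vec n" "U\<^sup>T *\<^sub>v v = 0\<^sub>v s"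
        have "v \<bullet> (A *\<^sub>v v) + v \<bullet> (B *\<^sub>v v) = v \<bullet> ((A + B) *\<^sub>v v)"
          using car v by (simp add: add_mult_distrib_mat_vec[of _ n n] scalar_prod_add_distrib[of _ n])
        also have "\<dots> = 0"
          unfolding Z(2) congruence_quadratic_form[OF car(3) U v(1)] v(2) using car by simp
        finally show "A *\<^sub>v v = 0\<^sub>v n"
          using psd_cone_nonneg[OF B v(1)] by (intro psd_cone_kernelI[OF A v(1)]) simp
      qed auto
      then show ?thesis by auto
    qed
    fix A B assume AB: "A \<in> psd_cone n" "B \<in> psd_cone n" "A + B \<in> ?F"
    then show "A \<in> ?F" by (rule key)
    have "A + B = B + A"
      using psd_cone_carrier[OF AB(1)] psd_cone_carrier[OF AB(2)] by (rule comm_add_mat)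
    with AB show "B \<in> ?F" by (intro key[of B A]) auto
  qed
  moreover have "U * U\<^sup>T \<in> ?F"
    using psd_cone_one[of s] U by (auto intro!: exI[of _ "1\<^sub>m s"])
  ultimately have "X \<in> ?F" using X unfolding min_face_def by blast
  then show ?thesis using that by auto
qed

section \<open>Trace inner product\<close>

lemma mat_trace_mult:
  assumes "A \<in> carrier_mat n m" "B \<in> carrier_mat m n"
  shows "mat_trace (A * B) = (\<Sum>i<n. \<Sum>j<m. A $$ (i, j) * B $$ (j, i))"
  using assms by (simp add: mat_trace_def scalar_prod_def atLeast0LessThan)

lemma mat_trace_mult_comm:
  assumes "A \<in> carrier_mat n m" "B \<in> carrier_mat m n"
  shows "mat_trace (A * B) = mat_trace (B * A)"
  unfolding mat_trace_mult[OF assms] mat_trace_mult[OF assms(2,1)]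
  by (subst sum.swap) (simp add: mult.commute)

text \<open>Cyclicity of the trace moves the left factor \<open>U\<close> to the right end. This
  turns conditions on \<open>X = U * Y * U\<^sup>T\<close> into conditions on
  \<open>Y\<close>.\<close>

lemma mat_trace_compress:
  assumes U: "U \<in> carrier_mat n s" and Y: "Y \<in> carrier_mat s s" and M: "M \<in> carrier_mat n n"
  shows "mat_trace (U * Y * U\<^sup>T * M) = mat_trace (Y * compress U M)"
proof -
  have "mat_trace (U * Y * U\<^sup>T * M) = mat_trace (U * (Y * (U\<^sup>T * M)))"
    using assms by (simp add: assoc_mult_mat[of _ n s _ n _ n] assoc_mult_mat[of _ n s _ s _ n] assoc_mult_mat[of _ s s _ n _ n])
  also have "\<dots> = mat_trace (Y * (U\<^sup>T * M) * U)"
    using assms by (intro mat_trace_mult_comm) auto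
  also have "Y * (U\<^sup>T * M) * U = Y * compress U M"
    unfolding compress_def using assms by (intro assoc_mult_mat[of _ s s _ n _ s]) auto
  finally show ?thesis .
qed

section \<open>Rank one matrices and nonnegativity of the trace product\<close>

definition outer :: "real vec \<Rightarrow> real mat" where
  "outer u = mat (dim_vec u) (dim_vec u) (\<lambda>(i, j). u $ i * u $ j)"

lemma outer_carrier: "u \<in> carrier_vec n \<Longrightarrow> outer u \<in> carrier_mat n n"
  by (auto simp: outer_def)

lemma outer_mult_vec:
  assumes "u \<in> carrier_vec n" "v \<in> carrier_vec n"
  shows "outer u *\<^sub>v v = (u \<bullet> v) \<cdot>\<^sub>v u"
  using assms by (intro eq_vecI) (auto simp: outer_def scalar_prod_def sum_distrib_left sum_distrib_right algebra_simps)

lemma outer_psd: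
  assumes u: "u \<in> carrier_vec n"
  shows "outer u \<in> psd_cone n"
proof (rule psd_coneI)
  show "(outer u)\<^sup>T = outer u" by (rule eq_matI) (auto simp: outer_def)
  fix v :: "real vec" assume v: "v \<in> carrier_vec n"
  have "v \<bullet> (outer u *\<^sub>v v) = (u \<bullet> v) * (u \<bullet> v)"
    using u v comm_scalar_prod[OF u v] by (simp add: outer_mult_vec)
  then show "0 \<le> v \<bullet> (outer u *\<^sub>v v)" by simp
qed (rule outer_carrier[OF u])

text \<open>Expresses the quadratic form of \<open>C\<close> as a trace product with a positive
  semidefinite matrix, so that trace inequalities give information on the form.\<close>

lemma mat_trace_outer_mult:
  assumes u: "u \<in> carrier_vec n" and C: "C \<in> carrier_mat n n"
  shows "mat_trace (outer u * C) = u \<bullet> (C *\<^sub>v u)"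
proof -
  have "mat_trace (outer u * C) = (\<Sum>i<n. \<Sum>j<n. u $ i * u $ j * C $$ (j, i))"
    using u by (subst mat_trace_mult[OF outer_carrier[OF u] C]) (simp add: outer_def)
  also have "\<dots> = (\<Sum>j<n. u $ j * (\<Sum>i<n. C $$ (j, i) * u $ i))"
    by (subst sum.swap) (simp add: sum_distrib_left mult_ac)
  also have "\<dots> = u \<bullet> (C *\<^sub>v u)"
    using u C by (simp add: scalar_prod_def atLeast0LessThan)
  finally show ?thesis .
qed

text \<open>The vector \<open>u\<close> is a Cholesky column. The form of \<open>Y - outer u\<close>
  at \<open>v\<close> is the minimum of the form of \<open>Y\<close> along the line through
  \<open>v\<close> in direction of the unit vector \<open>k\<close>.\<close>

lemma psd_cone_minus_rank_one:
  assumes Y: "Y \<in> psd_cone n" and k: "k < n" and pos: "0 < Y $$ (k, k)"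
  defines "u \<equiv> (1 / sqrt (Y $$ (k, k))) \<cdot>\<^sub>v col Y k"
  shows "Y - outer u \<in> psd_cone n"
proof (rule psd_coneI)
  note Yc = psd_cone_carrier[OF Y]
  have u: "u \<in> carrier_vec n" using Yc k unfolding u_def by auto
  note oc = outer_carrier[OF u]
  show "Y - outer u \<in> carrier_mat n n" using Yc oc by auto
  show "(Y - outer u)\<^sup>T = Y - outer u"
    using Yc oc psd_cone_transpose[OF Y] psd_cone_transpose[OF outer_psd[OF u]]
    by (simp add: transpose_minus)
  fix v :: "real vec" assume v: "v \<in> carrier_vec n"
  let ?e = "unit_vec n k"
  let ?c = "Y $$ (k, k)"
  have e: "?e \<in> carrier_vec n" by simp
  have Ye: "Y *\<^sub>v ?e = col Y k"
    using Yc k by (intro eq_vecI) auto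
  define s where "s = v \<bullet> col Y k"
  have eYv: "?e \<bullet> (Y *\<^sub>v v) = s"
    using sym_mats_scalar_prod[OF psd_cone_sym[OF Y] e v] unfolding Ye s_def .
  have eYe: "?e \<bullet> (Y *\<^sub>v ?e) = ?c" using Yc k unfolding Ye by simp
  have "u \<bullet> v = 1 / sqrt ?c * (col Y k \<bullet> v)"
    using Yc k v unfolding u_def by (simp add: smult_scalar_prod_distrib[of _ n])
  also have "col Y k \<bullet> v = s"
    unfolding s_def using Yc k v by (intro comm_scalar_prod[of _ n]) auto
  finally have uv: "u \<bullet> v = s / sqrt ?c" by simp
  \<comment> \<open>The coefficient \<open>- s / ?c\<close> is the minimiser along this
    line.\<close>
  have "0 \<le> (v + (- s / ?c) \<cdot>\<^sub>v ?e) \<bullet> (Y *\<^sub>v (v + (- s / ?c) \<cdot>\<^sub>v ?e))"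
    using v by (intro psd_cone_nonneg[OF Y]) auto
  also have "\<dots> = v \<bullet> (Y *\<^sub>v v) - s\<^sup>2 / ?c"
    unfolding quadratic_form_add_smult[OF psd_cone_sym[OF Y] v e] eYv eYe
    using pos by (simp add: divide_simps power2_eq_square)
  also have "\<dots> = v \<bullet> (Y *\<^sub>v v) - (u \<bullet> v) * (v \<bullet> u)"
    using comm_scalar_prod[OF u v, symmetric] pos uv by (simp add: power2_eq_square)
  also have "\<dots> = v \<bullet> ((Y - outer u) *\<^sub>v v)"
    using Yc oc u v
    by (simp add: minus_mult_distrib_mat_vec[of _ n n] scalar_prod_minus_distrib[of _ n] outer_mult_vec)
  finally show "0 \<le> v \<bullet> ((Y - outer u) *\<^sub>v v)" .
qed

text \<open>Subtracting a rank one matrix clears one column of \<open>Y\<close> after the other, as in the Cholesky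
  decomposition.\<close>
lemma psd_cone_induct [consumes 1, case_names zero outer]:
  assumes "Y \<in> psd_cone n"
    and zero: "P (0\<^sub>m n n)"
    and outer: "\<And>Y u. Y \<in> psd_cone n \<Longrightarrow> P Y \<Longrightarrow> u \<in> carrier_vec n \<Longrightarrow> P (Y + outer u)"
  shows "P Y"
proof -
  \<comment> \<open>Induction on \<open>k\<close>, where all columns with index at least
    \<open>k\<close> are already zero. The value \<open>k = n\<close> imposes no condition on the
    entries, and \<open>k = 0\<close> forces the zero matrix.\<close>
  have "P Y" if "Y \<in> psd_cone n" "\<forall>i<n. \<forall>j<n. k \<le> j \<longrightarrow> Y $$ (i, j) = 0" "k \<le> n" for Y k
    using that
  proof (induction k arbitrary: Y)
    case 0
    then have "Y = 0\<^sub>m n n" using psd_cone_carrier[of Y n] by (intro eq_matI) auto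
    then show ?case using zero by simp
  next
    case (Suc k)
    note Y = Suc.prems(1)
    note Yc = psd_cone_carrier[OF Y]
    have k: "k < n" using Suc.prems by simp
    let ?e = "unit_vec n k"
    have e: "?e \<in> carrier_vec n" by simp
    have Ye: "Y *\<^sub>v ?e = col Y k"
      using Yc k by (intro eq_vecI) auto
    have eYe: "?e \<bullet> (Y *\<^sub>v ?e) = Y $$ (k, k)" using Yc k unfolding Ye by simp
    have ge: "0 \<le> Y $$ (k, k)" using psd_cone_nonneg[OF Y e] unfolding eYe .
    show ?case
    proof (cases "Y $$ (k, k) = 0")
      case True
      \<comment> \<open>A zero diagonal entry puts the unit vector in the kernel, so the whole
        column vanishes and there is nothing to subtract.\<close>
      then have col0: "col Y k = 0\<^sub>v n"
        using psd_cone_kernelI[OF Y e] unfolding eYe unfolding Ye by simp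
      have "Y $$ (i, k) = 0" if "i < n" for i
        using arg_cong[OF col0, of "\<lambda>v. v $ i"] that k Yc by simp
      then have "\<forall>i<n. \<forall>j<n. k \<le> j \<longrightarrow> Y $$ (i, j) = 0"
        using Suc.prems(2) by (metis Suc_leI le_neq_implies_less)
      then show ?thesis using Suc.IH[OF Y] k by simp
    next
      case False
      with ge have pos: "0 < Y $$ (k, k)" by simp
      define u where "u = (1 / sqrt (Y $$ (k, k))) \<cdot>\<^sub>v col Y k"
      have u: "u \<in> carrier_vec n" using Yc k unfolding u_def by auto
      have psd: "Y - outer u \<in> psd_cone n"
        unfolding u_def by (rule psd_cone_minus_rank_one[OF Y k pos])
      \<comment> \<open>For \<open>j = k\<close> the two terms cancel. For \<open>j > k\<close> both
        terms are already zero, as symmetry gives \<open>Y $$ (j, k) = 0\<close>; the cleared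
        columns stay clear.\<close>
      have ent: "(Y - outer u) $$ (i, j) = Y $$ (i, j) - Y $$ (i, k) * Y $$ (j, k) / Y $$ (k, k)"
        if "i < n" "j < n" for i j
        using that Yc k pos by (simp add: outer_def u_def)
      have "\<forall>i<n. \<forall>j<n. k \<le> j \<longrightarrow> (Y - outer u) $$ (i, j) = 0"
      proof (intro allI impI)
        fix i j assume ij: "i < n" "j < n" "k \<le> j"
        show "(Y - outer u) $$ (i, j) = 0"
        proof (cases "j = k")
          case True
          then show ?thesis using ent ij pos by simp
        next
          case False
          then have "Y $$ (i, j) = 0" "Y $$ (k, j) = 0" using Suc.prems(2) ij k by auto
          moreover have "Y $$ (j, k) = Y $$ (k, j)"
            using sym_mats_index[OF psd_cone_sym[OF Y]] ij k by simp
          ultimately show ?thesis using ent ij by simp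
        qed
      qed
      then have "P (Y - outer u)" using Suc.IH[OF psd] k by simp
      from outer[OF psd this u] have "P (Y - outer u + outer u)" .
      moreover have "Y - outer u + outer u = Y"
        using Yc outer_carrier[OF u] by (intro eq_matI) auto
      ultimately show ?thesis by simp
    qed
  qed
  from this[of Y n] show ?thesis using assms(1) by simp
qed

text \<open>Both claims go through one induction: each \<open>outer u\<close> adds the nonnegative
  number \<open>u \<bullet> (C *\<^sub>v u)\<close>, and a nonpositive total forces every summand to
  vanish, hence \<open>C *\<^sub>v u = 0\<^sub>v n\<close>.\<close>

lemma psd_cone_trace_mult:
  assumes Y: "Y \<in> psd_cone n" and C: "C \<in> psd_cone n"
  shows "0 \<le> mat_trace (Y * C) \<and> (mat_trace (Y * C) \<le> 0 \<longrightarrow> C * Y = 0\<^sub>m n n)"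
  using Y
proof (induction rule: psd_cone_induct)
  case zero
  then show ?case using psd_cone_carrier[OF C] by (simp add: mat_trace_def)
next
  case (outer Y u)
  note car = psd_cone_carrier[OF outer.hyps(1)] psd_cone_carrier[OF C] outer_carrier[OF outer.hyps(2)]
  have tr: "mat_trace ((Y + outer u) * C) = mat_trace (Y * C) + u \<bullet> (C *\<^sub>v u)"
    unfolding mat_trace_outer_mult[OF outer.hyps(2) car(2), symmetric]
    using car by (simp add: add_mult_distrib_mat[of _ n n] mat_trace_def sum.distrib)
  have uCu: "0 \<le> u \<bullet> (C *\<^sub>v u)" by (rule psd_cone_nonneg[OF C outer.hyps(2)])
  have "C * (Y + outer u) = 0\<^sub>m n n" if "mat_trace ((Y + outer u) * C) \<le> 0"
  proof -
    have "C * Y = 0\<^sub>m n n" using that tr uCu outer.IH by linarith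
    moreover have Cu: "C *\<^sub>v u = 0\<^sub>v n"
      using that tr outer.IH by (intro psd_cone_kernelI[OF C outer.hyps(2)]) linarith
    have "C * outer u = 0\<^sub>m n n"
    proof (rule eq_matI)
      fix i j assume ij: "i < dim_row (0\<^sub>m n n)" "j < dim_col (0\<^sub>m n n)"
      have "(C * outer u) $$ (i, j) = (C *\<^sub>v u) $ i * u $ j"
        using ij car outer.hyps(2) by (auto simp: outer_def scalar_prod_def sum_distrib_right mult.assoc)
      then show "(C * outer u) $$ (i, j) = 0\<^sub>m n n $$ (i, j)" using Cu ij by simp
    qed (use car in auto)
    ultimately show ?thesis using car by (simp add: mult_add_distrib_mat[of _ n n])
  qed
  then show ?case using tr uCu outer.IH by simp
qed

text \<open>The trace condition gives \<open>C * Y = 0\<^sub>m d d\<close>, so the range of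
  \<open>Y\<close> lies in the kernel of \<open>C\<close>, which is the range of \<open>W\<close>.
  By symmetry \<open>Y\<close> vanishes on the kernel of \<open>W\<^sup>T\<close>.\<close>

lemma psd_cone_factor_kernel:
  assumes Y: "Y \<in> psd_cone d" and C: "C \<in> psd_cone d" and tr: "mat_trace (Y * C) \<le> 0"
    and W: "dim_row W = d" "full_col_rank W" "mat_range W = mat_kernel C"
  obtains Z where "Z \<in> psd_cone (dim_col W)" "Y = W * Z * W\<^sup>T"
proof (rule psd_cone_factor_through[OF Y _ W(2)])
  note car = psd_cone_carrier[OF Y] psd_cone_carrier[OF C]
  show W': "W \<in> carrier_mat d (dim_col W)" using W by auto
  have CY: "C * Y = 0\<^sub>m d d" using psd_cone_trace_mult[OF Y C] tr by simp
  fix v :: "real vec" assume v: "v \<in> carrier_vec d" "W\<^sup>T *\<^sub>v v = 0\<^sub>v (dim_col W)"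
  \<comment> \<open>The squared norm of \<open>?x\<close> equals
    \<open>v \<bullet> (Y *\<^sub>v ?x)\<close>, and \<open>Y *\<^sub>v ?x\<close> lies in the range
    of \<open>W\<close>, to which \<open>v\<close> is orthogonal.\<close>
  let ?x = "Y *\<^sub>v v"
  have x: "?x \<in> carrier_vec d" using car v by auto
  have "C *\<^sub>v (Y *\<^sub>v ?x) = (C * Y) *\<^sub>v ?x" using car x by (simp add: assoc_mult_mat_vec[of _ d d])
  also have "\<dots> = 0\<^sub>v d" unfolding CY using x by (intro eq_vecI) auto
  finally have "Y *\<^sub>v ?x \<in> mat_kernel C" using car x by (intro mat_kernelI[of _ d d]) auto
  then obtain z where z: "z \<in> carrier_vec (dim_col W)" "Y *\<^sub>v ?x = W *\<^sub>v z"
    unfolding W(3)[symmetric] mat_range_eq by auto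
  have "?x \<bullet> ?x = v \<bullet> (Y *\<^sub>v ?x)"
    using sym_mats_scalar_prod[OF psd_cone_sym[OF Y] x v(1)] .
  also have "\<dots> = (W\<^sup>T *\<^sub>v v) \<bullet> z"
    unfolding z(2) using transpose_vec_mult_scalar[OF W' z(1) v(1)] by simp
  also have "\<dots> = 0" unfolding v(2) using z by simp
  finally show "Y *\<^sub>v v = 0\<^sub>v d" using scalar_prod_self_eq_0[OF x] by simp
qed (use that in auto)

section \<open>Separation\<close>

definition pd_mats :: "nat \<Rightarrow> real mat set" where
  "pd_mats d = {Y \<in> sym_mats d. \<forall>v \<in> carrier_vec d. v \<noteq> 0\<^sub>v d \<longrightarrow> 0 < v \<bullet> (Y *\<^sub>v v)}"

lemma pd_mats_psd: "Y \<in> pd_mats d \<Longrightarrow> Y \<in> psd_cone d"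
  by (fastforce simp: pd_mats_def psd_cone_def sym_mats_def less_le)

lemma pd_mats_kernel:
  assumes "Y \<in> pd_mats d" "v \<in> carrier_vec d" "Y *\<^sub>v v = 0\<^sub>v d"
  shows "v = 0\<^sub>v d"
  using assms by (fastforce simp: pd_mats_def)

lemma pd_mats_add:
  assumes A: "A \<in> psd_cone d" and B: "B \<in> pd_mats d"
  shows "A + B \<in> pd_mats d"
proof -
  have AB: "A \<in> carrier_mat d d" "B \<in> carrier_mat d d"
    using psd_cone_carrier[OF A] psd_cone_carrier[OF pd_mats_psd[OF B]] by auto
  have "0 < v \<bullet> ((A + B) *\<^sub>v v)" if v: "v \<in> carrier_vec d" "v \<noteq> 0\<^sub>v d" for v
  proof -
    have "v \<bullet> ((A + B) *\<^sub>v v) = v \<bullet> (A *\<^sub>v v) + v \<bullet> (B *\<^sub>v v)"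
      using AB v by (simp add: add_mult_distrib_mat_vec[of _ d d] scalar_prod_add_distrib[of _ d])
    moreover have "0 < v \<bullet> (B *\<^sub>v v)" using B v by (simp add: pd_mats_def)
    ultimately show ?thesis using psd_cone_nonneg[OF A v(1)] by simp
  qed
  then show ?thesis
    using psd_cone_sym[OF psd_cone_add[OF A pd_mats_psd[OF B]]] by (simp add: pd_mats_def)
qed

lemma pd_mats_smult:
  assumes B: "B \<in> pd_mats d" and c: "0 < c"
  shows "c \<cdot>\<^sub>m B \<in> pd_mats d"
proof -
  have "B \<in> carrier_mat d d" using psd_cone_carrier[OF pd_mats_psd[OF B]] .
  then show ?thesis
    using psd_cone_sym[OF psd_cone_smult[OF pd_mats_psd[OF B], of c]] B c
    by (simp add: pd_mats_def smult_mult_mat_vec)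
qed

lemma pd_mats_one: "1\<^sub>m d \<in> pd_mats d"
  using psd_cone_sym[OF psd_cone_one[of d]] scalar_prod_self_nonneg scalar_prod_self_eq_0
  by (auto simp: pd_mats_def less_le)

section \<open>Linear combinations, compressions and the theorem of the alternative\<close>

lemma mat_lincomb_carrier [simp]: "mat_lincomb n x A \<in> carrier_mat n n"
  by (simp add: mat_lincomb_def)

lemma mat_lincomb_sym:
  assumes "\<And>i. A i \<in> sym_mats n"
  shows "mat_lincomb n x A \<in> sym_mats n"
  using sym_mats_index[OF assms] by (auto simp: sym_mats_def mat_lincomb_def intro!: eq_matI sum.cong)

lemma mat_trace_lincomb:
  assumes X: "X \<in> carrier_mat n n" and A: "\<And>i. A i \<in> carrier_mat n n"
  shows "mat_trace (X * mat_lincomb n x A) = (\<Sum>i\<in>UNIV. x i * mat_trace (X * A i))"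
proof -
  have "mat_trace (X * mat_lincomb n x A)
      = (\<Sum>p<n. \<Sum>q<n. \<Sum>i\<in>UNIV. x i * (X $$ (p, q) * A i $$ (q, p)))"
    unfolding mat_trace_mult[OF X mat_lincomb_carrier]
    by (simp add: mat_lincomb_def sum_distrib_left mult_ac)
  also have "\<dots> = (\<Sum>i\<in>UNIV. \<Sum>p<n. \<Sum>q<n. x i * (X $$ (p, q) * A i $$ (q, p)))"
    by (simp only: sum.swap[of _ UNIV])
  finally show ?thesis
    unfolding mat_trace_mult[OF X A] by (simp add: sum_distrib_left)
qed

lemma compress_carrier: "U \<in> carrier_mat n s \<Longrightarrow> compress U M \<in> carrier_mat s s"
  by (auto simp: compress_def)

lemma compress_sym:
  assumes "M \<in> sym_mats n" "U \<in> carrier_mat n s"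
  shows "compress U M \<in> sym_mats s"
  using sym_mats_congruence[OF assms(1), of "U\<^sup>T" s] assms(2) by (simp add: compress_def)

lemma compress_index:
  assumes "U \<in> carrier_mat n s" "M \<in> carrier_mat n n" "p < s" "q < s"
  shows "compress U M $$ (p, q) = (\<Sum>i<n. \<Sum>j<n. U $$ (i, p) * M $$ (i, j) * U $$ (j, q))"
  using assms by (simp add: compress_def scalar_prod_def atLeast0LessThan sum_distrib_left mult.assoc)

text \<open>Compression is linear, so coefficients found for the compressed matrices serve for the
  original ones.\<close>

lemma compress_lincomb:
  assumes U: "U \<in> carrier_mat n s" and A: "\<And>i. A i \<in> carrier_mat n n"
  shows "compress U (mat_lincomb n x A) = mat_lincomb s x (\<lambda>i. compress U (A i))"
proof (rule eq_matI)
  fix p q assume "p < dim_row (mat_lincomb s x (\<lambda>i. compress U (A i)))"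
    "q < dim_col (mat_lincomb s x (\<lambda>i. compress U (A i)))"
  then have pq: "p < s" "q < s" by (simp_all add: mat_lincomb_def)
  have "compress U (mat_lincomb n x A) $$ (p, q)
      = (\<Sum>i<n. \<Sum>j<n. \<Sum>k\<in>UNIV. x k * (U $$ (i, p) * A k $$ (i, j) * U $$ (j, q)))"
    unfolding compress_index[OF U mat_lincomb_carrier pq]
    by (simp add: mat_lincomb_def sum_distrib_left sum_distrib_right mult_ac)
  also have "\<dots> = (\<Sum>k\<in>UNIV. \<Sum>i<n. \<Sum>j<n. x k * (U $$ (i, p) * A k $$ (i, j) * U $$ (j, q)))"
    by (simp only: sum.swap[of _ UNIV])
  also have "\<dots> = mat_lincomb s x (\<lambda>i. compress U (A i)) $$ (p, q)"
    using pq by (simp add: mat_lincomb_def compress_index[OF U A pq] sum_distrib_left)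
  finally show "compress U (mat_lincomb n x A) $$ (p, q) = mat_lincomb s x (\<lambda>i. compress U (A i)) $$ (p, q)" .
qed (use compress_carrier[OF U] in \<open>auto simp: mat_lincomb_def\<close>)

lemma mat_trace_add_mult:
  assumes "X \<in> carrier_mat n m" "Y \<in> carrier_mat n m" "B \<in> carrier_mat m n"
  shows "mat_trace ((X + Y) * B) = mat_trace (X * B) + mat_trace (Y * B)"
  using assms by (simp add: mat_trace_mult[of _ n m] sum.distrib distrib_right)

lemma mat_trace_smult_mult:
  assumes "X \<in> carrier_mat n m" "B \<in> carrier_mat m n"
  shows "mat_trace ((c \<cdot>\<^sub>m X) * B) = c * mat_trace (X * B)"
  using assms by (simp add: mat_trace_mult[of _ n m] sum_distrib_left mult_ac)

text \<open>A theorem of the alternative. The trace vectors of positive definite matrices, shifted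
  by that of \<open>Y0\<close>, form a convex set \<open>S\<close> in \<real>^m that misses 0. A
  normal vector of a separating hyperplane supplies the coefficients.\<close>

lemma psd_lincomb_exists:
  fixes B :: "'m::finite \<Rightarrow> real mat"
  assumes B: "\<And>i. B i \<in> sym_mats d" and Y0: "Y0 \<in> carrier_mat d d"
    and no_pd: "\<And>Y. Y \<in> pd_mats d \<Longrightarrow> \<exists>i. mat_trace (Y * B i) \<noteq> mat_trace (Y0 * B i)"
  obtains x where "mat_lincomb d x B \<in> psd_cone d" "mat_lincomb d x B \<noteq> 0\<^sub>m d d"
    "mat_trace (Y0 * mat_lincomb d x B) \<le> 0"
proof -
  have Bc: "B i \<in> carrier_mat d d" for i using B[of i] by (simp add: sym_mats_def)
  have pdc: "Y \<in> carrier_mat d d" if "Y \<in> pd_mats d" for Y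
    using psd_cone_carrier[OF pd_mats_psd[OF that]] .
  define L :: "real mat \<Rightarrow> real ^ 'm" where "L Y = vec_lambda (\<lambda>i. mat_trace (Y * B i))" for Y
  have L_add: "L (X + Y) = L X + L Y" if "X \<in> carrier_mat d d" "Y \<in> carrier_mat d d" for X Y
    using that by (simp add: L_def Finite_Cartesian_Product.vec_eq_iff mat_trace_add_mult[of _ d d] Bc)
  have L_smult: "L (c \<cdot>\<^sub>m X) = c *\<^sub>R L X" if "X \<in> carrier_mat d d" for X c
    using that by (simp add: L_def Finite_Cartesian_Product.vec_eq_iff mat_trace_smult_mult[of _ d d] Bc)
  define S where "S = (\<lambda>Y. L Y - L Y0) ` pd_mats d"
  have conv: "convex S"
    unfolding convex_alt
  proof (intro ballI allI impI)
    fix a b and u :: real assume "a \<in> S" "b \<in> S" and u: "0 \<le> u \<and> u \<le> 1"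
    then obtain X Y where XY: "X \<in> pd_mats d" "a = L X - L Y0" "Y \<in> pd_mats d" "b = L Y - L Y0"
      unfolding S_def by auto
    \<comment> \<open>Scaling preserves definiteness only for positive factors, so
      \<open>u = 0\<close> is separate; otherwise the term with \<open>Y\<close> is definite and the
      term with \<open>X\<close> semidefinite.\<close>
    show "(1 - u) *\<^sub>R a + u *\<^sub>R b \<in> S"
    proof (cases "u = 0")
      case True
      then show ?thesis using XY unfolding S_def by auto
    next
      case False
      let ?Z = "(1 - u) \<cdot>\<^sub>m X + u \<cdot>\<^sub>m Y"
      have "?Z \<in> pd_mats d"
        using XY u False by (intro pd_mats_add pd_mats_smult psd_cone_smult pd_mats_psd) auto
      moreover have "(1 - u) *\<^sub>R a + u *\<^sub>R b = L ?Z - L Y0"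
        using pdc[OF XY(1)] pdc[OF XY(3)] unfolding XY(2,4)
        by (simp add: L_add L_smult algebra_simps)
      ultimately show ?thesis unfolding S_def by blast
    qed
  qed
  have ne: "S \<noteq> {}" unfolding S_def using pd_mats_one by auto
  have z: "0 \<notin> S"
    unfolding S_def using no_pd by (fastforce simp: L_def Finite_Cartesian_Product.vec_eq_iff)
  \<comment> \<open>Taking \<open>a\<close> in the span of \<open>S\<close> makes it a trace vector
    \<open>L Z\<close>. Then \<open>inner a a\<close> is the trace of \<open>Z * ?C\<close>, which
    rules out \<open>?C\<close> being zero.\<close>
  obtain a where a: "a \<in> span S" "a \<noteq> 0" "\<And>y. y \<in> S \<Longrightarrow> 0 \<le> inner a y"
    using separating_hyperplane_set_0_inspan[OF conv ne z] by blast
  define x where "x = vec_nth a"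
  let ?C = "mat_lincomb d x B"
  have inner_L: "inner a (L Y) = mat_trace (Y * ?C)" if "Y \<in> carrier_mat d d" for Y
    unfolding mat_trace_lincomb[OF that Bc] by (simp add: inner_vec_def L_def x_def)
  have C_sym: "?C \<in> sym_mats d" by (rule mat_lincomb_sym[OF B])
  have "span S \<subseteq> L ` carrier_mat d d"
  proof (rule span_minimal)
    show "S \<subseteq> L ` carrier_mat d d"
    proof
      fix y assume "y \<in> S"
      then obtain Y where Y: "Y \<in> pd_mats d" "y = L Y - L Y0" unfolding S_def by auto
      have "y = L (Y + (-1) \<cdot>\<^sub>m Y0)" using Y Y0 pdc[OF Y(1)] by (simp add: L_add L_smult)
      then show "y \<in> L ` carrier_mat d d" using Y0 pdc[OF Y(1)] by auto
    qed
    show "Real_Vector_Spaces.subspace (L ` carrier_mat d d)"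
    proof (rule Real_Vector_Spaces.subspaceI)
      have "L (0 \<cdot>\<^sub>m Y0) = 0" using L_smult[OF Y0] by simp
      then show "0 \<in> L ` carrier_mat d d" using Y0 by (metis imageI smult_carrier_mat)
      show "v + w \<in> L ` carrier_mat d d" if "v \<in> L ` carrier_mat d d" "w \<in> L ` carrier_mat d d" for v w
        using that L_add[symmetric] by auto
      show "c *\<^sub>R v \<in> L ` carrier_mat d d" if "v \<in> L ` carrier_mat d d" for v c
        using that L_smult[symmetric] by auto
    qed
  qed
  then obtain Z where Z: "Z \<in> carrier_mat d d" "a = L Z" using a(1) by auto
  have nz: "?C \<noteq> 0\<^sub>m d d"
  proof
    assume C0: "?C = 0\<^sub>m d d"
    have "inner a a = mat_trace (Z * 0\<^sub>m d d)" using inner_L[OF Z(1)] Z(2) C0 by simp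
    also have "\<dots> = 0" using Z(1) by (simp add: mat_trace_def)
    finally show False using a(2) by simp
  qed
  have sep: "mat_trace (Y0 * ?C) \<le> mat_trace (Y * ?C)" if "Y \<in> pd_mats d" for Y
  proof -
    have "0 \<le> inner a (L Y - L Y0)" using a(3) that unfolding S_def by blast
    then show ?thesis using inner_L[OF pdc[OF that]] inner_L[OF Y0] by (simp add: inner_diff_right)
  qed
  \<comment> \<open>A negative trace could be scaled below the lower bound from \<open>sep\<close>:
    the factor \<open>t\<close> makes it \<open>- (\<bar>?q\<bar> + 1)\<close>, which is less than
    \<open>?q\<close>.\<close>
  have nonneg: "0 \<le> mat_trace (Y * ?C)" if Y: "Y \<in> pd_mats d" for Y
  proof (rule ccontr)
    let ?p = "mat_trace (Y * ?C)" and ?q = "mat_trace (Y0 * ?C)"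
    assume "\<not> 0 \<le> ?p"
    then have p: "?p < 0" by simp
    define t where "t = (\<bar>?q\<bar> + 1) / - ?p"
    have t: "0 < t" unfolding t_def using p by (intro divide_pos_pos) auto
    have "?q \<le> t * ?p"
      using sep[OF pd_mats_smult[OF Y t]] pdc[OF Y] by (simp add: mat_trace_smult_mult[of _ d d])
    also have "t * ?p = - (\<bar>?q\<bar> + 1)" unfolding t_def using p by simp
    finally show False by simp
  qed
  \<comment> \<open>Small positive multiples of the identity in \<open>sep\<close> bound the trace
    at \<open>Y0\<close> by every \<open>e > 0\<close>.\<close>
  have le0: "mat_trace (Y0 * ?C) \<le> 0"
  proof (rule field_le_epsilon)
    fix e :: real assume e: "0 < e"
    let ?p = "mat_trace (1\<^sub>m d * ?C)"
    have p: "0 \<le> ?p" by (rule nonneg[OF pd_mats_one])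
    define t where "t = e / (?p + 1)"
    have t: "0 < t" unfolding t_def using p e by simp
    have "mat_trace (Y0 * ?C) \<le> t * ?p"
      using sep[OF pd_mats_smult[OF pd_mats_one t]]
      unfolding mat_trace_smult_mult[OF one_carrier_mat mat_lincomb_carrier] .
    also have "\<dots> \<le> e" unfolding t_def using p e by (simp add: divide_simps mult_left_mono)
    finally show "mat_trace (Y0 * ?C) \<le> 0 + e" by simp
  qed
  \<comment> \<open>The matrix \<open>outer v\<close> is only semidefinite, so it is perturbed by
    \<open>t\<close> times the identity before \<open>nonneg\<close> applies.\<close>
  have "0 \<le> v \<bullet> (?C *\<^sub>v v)" if v: "v \<in> carrier_vec d" for v
  proof (rule field_le_epsilon)
    fix e :: real assume e: "0 < e"
    let ?p = "mat_trace (1\<^sub>m d * ?C)"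
    have p: "0 \<le> ?p" by (rule nonneg[OF pd_mats_one])
    define t where "t = e / (?p + 1)"
    have t: "0 < t" unfolding t_def using p e by simp
    have pd: "outer v + t \<cdot>\<^sub>m 1\<^sub>m d \<in> pd_mats d"
      by (intro pd_mats_add pd_mats_smult pd_mats_one outer_psd v t)
    have "mat_trace ((outer v + t \<cdot>\<^sub>m 1\<^sub>m d) * ?C) = v \<bullet> (?C *\<^sub>v v) + t * ?p"
      unfolding mat_trace_outer_mult[OF v mat_lincomb_carrier, symmetric]
        mat_trace_smult_mult[OF one_carrier_mat mat_lincomb_carrier, symmetric]
      using outer_carrier[OF v] by (intro mat_trace_add_mult[of _ d d]) auto
    with nonneg[OF pd] have "0 \<le> v \<bullet> (?C *\<^sub>v v) + t * ?p" by simp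
    also have "t * ?p \<le> e" unfolding t_def using p e by (simp add: divide_simps mult_left_mono)
    finally show "0 \<le> v \<bullet> (?C *\<^sub>v v) + e" by simp
  qed
  then have "?C \<in> psd_cone d" using C_sym by (simp add: psd_cone_def)
  then show ?thesis using that nz le0 by blast
qed

section \<open>Facial reduction\<close>

text \<open>The right-hand side does not depend on \<open>X\<close>, so a sign established at one
  feasible matrix holds at all of them.\<close>

lemma feasible_trace_lincomb:
  assumes A: "\<And>i. A i \<in> sym_mats n" and X: "X \<in> feasible_set n A b"
  shows "mat_trace (X * mat_lincomb n x A) = (\<Sum>i\<in>UNIV. x i * b i)"
proof -
  have "X \<in> carrier_mat n n" using X psd_cone_carrier by (auto simp: feasible_set_def)
  moreover have "A i \<in> carrier_mat n n" for i using A[of i] by (simp add: sym_mats_def)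
  ultimately show ?thesis
    using X by (simp add: mat_trace_lincomb feasible_set_def)
qed

lemma mat_rank_congruence_le:
  assumes "U \<in> carrier_mat n d" "Y \<in> carrier_mat d d"
  shows "mat_rank (U * Y * U\<^sup>T) \<le> d"
proof -
  have "mat_rank (U * Y * U\<^sup>T) \<le> mat_rank (U * Y)"
    using assms by (intro mat_rank_mult_le[of _ n d]) auto
  also have "\<dots> \<le> d" using mat_rank_le_dim_col[of "U * Y"] assms by simp
  finally show ?thesis .
qed

text \<open>\<open>U * Y\<close> has full column rank and is recovered from
  \<open>U * Y * U\<^sup>T\<close> by a right inverse of \<open>U\<^sup>T\<close>. Hence a positive
  definite feasible \<open>Y\<close> would produce a feasible matrix of rank
  \<open>d\<close>.\<close>

lemma mat_rank_congruence_pd: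
  assumes U: "U \<in> carrier_mat n d" and fr: "full_col_rank U" and Y: "Y \<in> pd_mats d"
  shows "mat_rank (U * Y * U\<^sup>T) = d"
proof -
  note Yc = psd_cone_carrier[OF pd_mats_psd[OF Y]]
  obtain V where V: "V \<in> carrier_mat d n" "V * U = 1\<^sub>m d"
    using full_col_rank_left_inverse[OF U fr] .
  have UY: "full_col_rank (U * Y)"
    by (rule full_col_rank_mult[OF fr _ U Yc], rule full_col_rankI[OF Yc])
      (rule pd_mats_kernel[OF Y])
  have "U\<^sup>T * V\<^sup>T = 1\<^sub>m d" using U V transpose_mult[OF V(1) U] by simp
  then have "U * Y * U\<^sup>T * V\<^sup>T = U * Y"
    using U V(1) Yc by (simp add: assoc_mult_mat[of _ n d _ n _ d])
  then have "mat_rank (U * Y) \<le> mat_rank (U * Y * U\<^sup>T)"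
    using mat_rank_mult_le[of "U * Y * U\<^sup>T" n n "V\<^sup>T" d] U V Yc by simp
  moreover have "mat_rank (U * Y) = d" using UY U Yc by (simp add: full_col_rank_def)
  ultimately show ?thesis
    using mat_rank_congruence_le[OF U Yc] by simp
qed

lemma congruence_mult:
  fixes U W Z :: "real mat"
  assumes U: "U \<in> carrier_mat n d" and W: "W \<in> carrier_mat d m" and Z: "Z \<in> carrier_mat m m"
  shows "(U * W) * Z * (U * W)\<^sup>T = U * (W * Z * W\<^sup>T) * U\<^sup>T"
proof -
  have "(U * W) * Z * (U * W)\<^sup>T = (U * W) * Z * (W\<^sup>T * U\<^sup>T)"
    by (simp add: transpose_mult[OF U W])
  also have "\<dots> = (U * W) * Z * W\<^sup>T * U\<^sup>T"
    using U W Z by (intro assoc_mult_mat[symmetric, of _ n m _ d _ n]) auto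
  also have "(U * W) * Z * W\<^sup>T = U * (W * Z * W\<^sup>T)"
    using U W Z by (simp add: assoc_mult_mat[OF U W Z] assoc_mult_mat[of _ n d _ m _ d])
  finally show ?thesis .
qed

text \<open>One step of facial reduction: the trace condition on \<open>X\<close> passes to
  \<open>Y\<close>, which then factors through the kernel of the compressed matrix.\<close>

lemma factor_reduce:
  assumes U: "U \<in> carrier_mat n d" and X: "\<exists>Y \<in> psd_cone d. X = U * Y * U\<^sup>T"
    and M: "M \<in> carrier_mat n n" "compress U M \<in> psd_cone d" "mat_trace (X * M) \<le> 0"
    and W: "dim_row W = d" "full_col_rank W" "mat_range W = mat_kernel (compress U M)"
  shows "\<exists>Y \<in> psd_cone (dim_col W). X = (U * W) * Y * (U * W)\<^sup>T"
proof -
  obtain Y where Y: "Y \<in> psd_cone d" "X = U * Y * U\<^sup>T" using X by blast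
  have "mat_trace (Y * compress U M) \<le> 0"
    using mat_trace_compress[OF U psd_cone_carrier[OF Y(1)] M(1)] M(3) Y(2) by simp
  from psd_cone_factor_kernel[OF Y(1) M(2) this W]
  obtain Z where Z: "Z \<in> psd_cone (dim_col W)" "Y = W * Z * W\<^sup>T" .
  have W': "W \<in> carrier_mat d (dim_col W)" using W by auto
  have "X = (U * W) * Z * (U * W)\<^sup>T"
    unfolding Y(2) Z(2) by (rule congruence_mult[OF U W' psd_cone_carrier[OF Z(1)], symmetric])
  then show ?thesis using Z(1) by blast
qed

text \<open>Collects the conditions on a single index of a chain, so that chains can be treated by
  induction on their length.\<close>

definition reduction_step ::
  "nat \<Rightarrow> ('m::finite \<Rightarrow> real mat) \<Rightarrow> real mat \<Rightarrow> real mat \<Rightarrow> ('m \<Rightarrow> real)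
    \<Rightarrow> real mat \<Rightarrow> real mat \<Rightarrow> real mat \<Rightarrow> bool" where
  "reduction_step n A X M x U W U' \<longleftrightarrow>
     (full_col_rank W \<and> dim_row W = dim_col U \<and> mat_range W = mat_kernel (compress U M) \<and>
      U' = U * W \<and> full_col_rank U') \<and>
     M \<noteq> 0\<^sub>m n n \<and> M = mat_lincomb n x A \<and> compress U M \<in> psd_cone (dim_col U) \<and>
     mat_trace (X * M) \<le> 0"

text \<open>\<open>factor_reduce\<close> applies to any feasible \<open>X\<close>, not only to
  \<open>Xstar\<close>. By rank-nullity the number of columns of \<open>U j\<close> plus the ranks
  used so far stays equal to \<open>s\<close>.\<close>

lemma reduction_chain_factor:
  assumes A: "\<And>i. A i \<in> sym_mats n" and U0: "U 0 \<in> carrier_mat n s"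
    and chain: "\<forall>j\<le>k. reduction_step n A Xstar (\<Omega> j) (x j) (U j) (W j) (U (Suc j))"
    and Xstar: "Xstar \<in> feasible_set n A b" and X: "X \<in> feasible_set n A b"
    and fac: "\<exists>Y \<in> psd_cone s. X = U 0 * Y * (U 0)\<^sup>T" and j: "j \<le> Suc k"
  shows "\<exists>d. U j \<in> carrier_mat n d \<and> d + (\<Sum>i<j. mat_rank (compress (U i) (\<Omega> i))) = s
    \<and> (\<exists>Y \<in> psd_cone d. X = U j * Y * (U j)\<^sup>T)"
  using j
proof (induction j)
  case 0
  then show ?case using U0 fac by auto
next
  case (Suc j)
  then have jk: "j \<le> k" by simp
  with Suc obtain d where Uj: "U j \<in> carrier_mat n d"
    and d: "d + (\<Sum>i<j. mat_rank (compress (U i) (\<Omega> i))) = s"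
    and fac: "\<exists>Y \<in> psd_cone d. X = U j * Y * (U j)\<^sup>T" by auto
  have dim: "dim_col (U j) = d" using Uj by simp
  have \<Omega>: "\<Omega> j = mat_lincomb n (x j) A" and tr: "mat_trace (Xstar * \<Omega> j) \<le> 0"
    and psd: "compress (U j) (\<Omega> j) \<in> psd_cone d"
    and W: "dim_row (W j) = d" "full_col_rank (W j)"
      "mat_range (W j) = mat_kernel (compress (U j) (\<Omega> j))" and US: "U (Suc j) = U j * W j"
    using chain jk unfolding reduction_step_def dim[symmetric] by auto
  have \<Omega>c: "\<Omega> j \<in> carrier_mat n n" unfolding \<Omega> by simp
  \<comment> \<open>Both traces equal the combination of the \<open>b i\<close> with coefficients
    \<open>x j i\<close>.\<close>
  have "mat_trace (X * \<Omega> j) \<le> 0"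
    using tr unfolding \<Omega> feasible_trace_lincomb[OF A X] feasible_trace_lincomb[OF A Xstar] .
  from factor_reduce[OF Uj fac \<Omega>c psd this W]
  have "\<exists>Y \<in> psd_cone (dim_col (W j)). X = U (Suc j) * Y * (U (Suc j))\<^sup>T" unfolding US .
  moreover have "U (Suc j) \<in> carrier_mat n (dim_col (W j))"
    unfolding US by (rule mult_carrier_mat[OF Uj carrier_matI[OF W(1) refl]])
  moreover have "dim_col (W j) + (\<Sum>i<Suc j. mat_rank (compress (U i) (\<Omega> i))) = s"
    using kernel_matrix_dim_col[OF compress_carrier[OF Uj] W] d by simp
  ultimately show ?case by blast
qed

text \<open>Strong induction on the number \<open>d\<close> of columns, with \<open>U0\<close>
  arbitrary and \<open>Xstar\<close> fixed. Each of the \<open>k + 1\<close> steps lowers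
  \<open>d\<close> by a positive rank, which accounts for \<open>k < d - r\<close>.\<close>

lemma reduction_chain_exists:
  fixes A :: "'m::finite \<Rightarrow> real mat"
  assumes A: "\<And>i. A i \<in> sym_mats n"
    and Xstar: "Xstar \<in> feasible_set n A b" "mat_rank Xstar = r"
    and max: "\<And>X. X \<in> feasible_set n A b \<Longrightarrow> mat_rank X \<le> r"
  shows "U0 \<in> carrier_mat n d \<Longrightarrow> full_col_rank U0 \<Longrightarrow> r < d \<Longrightarrow>
    \<exists>Y \<in> psd_cone d. Xstar = U0 * Y * U0\<^sup>T \<Longrightarrow>
    \<exists>k < d - r. \<exists>\<Omega> x U W. U 0 = U0 \<and> (\<forall>j\<le>k. reduction_step n A Xstar (\<Omega> j) (x j) (U j) (W j) (U (Suc j))) \<and>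
      (\<Sum>j\<le>k. mat_rank (compress (U j) (\<Omega> j))) = d - r"
proof (induction d arbitrary: U0 rule: less_induct)
  case (less d)
  note U0 = less.prems(1) and fr = less.prems(2) and rd = less.prems(3)
  have Ac: "A i \<in> carrier_mat n n" for i using A[of i] by (simp add: sym_mats_def)
  obtain Y0 where Y0: "Y0 \<in> psd_cone d" "Xstar = U0 * Y0 * U0\<^sup>T" using less.prems(4) by blast
  note Y0c = psd_cone_carrier[OF Y0(1)]
  let ?B = "\<lambda>i. compress U0 (A i)"
  \<comment> \<open>The alternative is applied in reduced coordinates. A positive definite
    \<open>Y\<close> with the same traces as \<open>Y0\<close> would give a feasible matrix of rank
    \<open>d > r\<close>.\<close>
  obtain x where x: "mat_lincomb d x ?B \<in> psd_cone d" "mat_lincomb d x ?B \<noteq> 0\<^sub>m d d"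
    "mat_trace (Y0 * mat_lincomb d x ?B) \<le> 0"
  proof (rule psd_lincomb_exists[of ?B d Y0])
    show "compress U0 (A i) \<in> sym_mats d" for i by (rule compress_sym[OF A U0])
    show "Y0 \<in> carrier_mat d d" by (rule Y0c)
    fix Y assume Y: "Y \<in> pd_mats d"
    show "\<exists>i. mat_trace (Y * ?B i) \<noteq> mat_trace (Y0 * ?B i)"
    proof (rule ccontr)
      assume "\<not> ?thesis"
      then have "mat_trace (U0 * Y * U0\<^sup>T * A i) = mat_trace (Xstar * A i)" for i
        using mat_trace_compress[OF U0 _ Ac] psd_cone_carrier[OF pd_mats_psd[OF Y]] Y0c Y0(2) by simp
      then have "U0 * Y * U0\<^sup>T \<in> feasible_set n A b"
        using Xstar(1) psd_cone_congruence[OF pd_mats_psd[OF Y] U0] by (simp add: feasible_set_def)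
      then show False using max mat_rank_congruence_pd[OF U0 fr Y] rd by fastforce
    qed
  qed blast
  define M where "M = mat_lincomb n x A"
  have M: "M \<in> carrier_mat n n" unfolding M_def by simp
  have CM: "compress U0 M = mat_lincomb d x ?B" unfolding M_def by (rule compress_lincomb[OF U0 Ac])
  have Cc: "compress U0 M \<in> carrier_mat d d" by (rule compress_carrier[OF U0])
  have Mnz: "M \<noteq> 0\<^sub>m n n"
  proof
    assume "M = 0\<^sub>m n n"
    then have "compress U0 M = 0\<^sub>m d d" using U0 by (simp add: compress_def)
    then show False using x(2) CM by simp
  qed
  have trM: "mat_trace (Xstar * M) \<le> 0"
    using mat_trace_compress[OF U0 Y0c M] Y0(2) x(3) CM by simp
  obtain W where W: "dim_row W = d" "full_col_rank W" "mat_range W = mat_kernel (compress U0 M)"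
    using kernel_matrix_exists[OF Cc] .
  define d1 where "d1 = dim_col W"
  have dim: "mat_rank (compress U0 M) + d1 = d" unfolding d1_def by (rule kernel_matrix_dim_col[OF Cc W])
  have pos: "0 < mat_rank (compress U0 M)" using mat_rank_pos[OF Cc] x(2) CM by simp
  have W': "W \<in> carrier_mat d d1" using W d1_def by auto
  have U1: "U0 * W \<in> carrier_mat n d1" using U0 W' by simp
  have fr1: "full_col_rank (U0 * W)" by (rule full_col_rank_mult[OF fr W(2) U0 W'])
  have fac1: "\<exists>Y \<in> psd_cone d1. Xstar = (U0 * W) * Y * (U0 * W)\<^sup>T"
    using factor_reduce[OF U0 less.prems(4) M _ trM W] x(1) CM unfolding d1_def by simp
  \<comment> \<open>The order cannot fall below \<open>r\<close>, since \<open>Xstar\<close> still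
    factors through \<open>d1\<close> columns.\<close>
  then have rd1: "r \<le> d1"
    using mat_rank_congruence_le[OF U1] psd_cone_carrier Xstar(2) by blast
  have step: "reduction_step n A Xstar M x U0 W (U0 * W)"
    unfolding reduction_step_def using W U0 fr1 Mnz x(1) CM trM by (simp add: M_def)
  show ?case
  \<comment> \<open>If the order has reached \<open>r\<close>, this single step is the whole chain,
    with \<open>k = 0\<close>.\<close>
  proof (cases "r = d1")
    case True
    then show ?thesis
      using step rd dim by (intro exI[of _ 0] conjI exI[of _ "\<lambda>_. M"] exI[of _ "\<lambda>_. x"]
          exI[of _ "case_nat U0 (\<lambda>_. U0 * W)"] exI[of _ "\<lambda>_. W"]) auto
  next
    case False
    then have rlt: "r < d1" using rd1 by simp
    have "d1 < d" using dim pos by simp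
    from less.IH[OF this U1 fr1 rlt fac1]
    obtain k \<Omega> y U V where IH: "k < d1 - r" "U 0 = U0 * W"
      "\<forall>j\<le>k. reduction_step n A Xstar (\<Omega> j) (y j) (U j) (V j) (U (Suc j))"
      "(\<Sum>j\<le>k. mat_rank (compress (U j) (\<Omega> j))) = d1 - r" by blast
    \<comment> \<open>\<open>case_nat\<close> prepends the current step at index 0 and shifts the
      chain from the induction hypothesis by one.\<close>
    let ?\<Omega> = "case_nat M \<Omega>" and ?y = "case_nat x y" and ?U = "case_nat U0 U" and ?V = "case_nat W V"
    have steps: "\<forall>j\<le>Suc k. reduction_step n A Xstar (?\<Omega> j) (?y j) (?U j) (?V j) (?U (Suc j))"
      using step IH(2,3) by (auto split: nat.split)
    have sum: "(\<Sum>j\<le>Suc k. mat_rank (compress (?U j) (?\<Omega> j))) = d - r"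
      unfolding sum.atMost_Suc_shift using IH(4) dim rlt by simp
    have k: "Suc k < d - r" using IH(1) dim pos rlt by linarith
    have U: "?U 0 = U0" by simp
    from k U steps sum show ?thesis by blast
  qed
qed

theorem theorem2p2:
  fixes n s r :: nat
    and A :: "'m::finite \<Rightarrow> real mat"
    and b :: "'m \<Rightarrow> real"
    and U0 Xstar Ystar :: "real mat"
  assumes "\<forall>i. A i \<in> sym_mats n"
    and "\<exists>i. b i \<noteq> 0"
    and "U0 \<in> carrier_mat n s"
    and "full_col_rank U0"
    and "feasible_set n A b \<subseteq> min_face n (U0 * transpose_mat U0)"
    and "Ystar \<in> carrier_mat s s"
    and "Xstar = U0 * Ystar * transpose_mat U0"
    and "Xstar \<in> feasible_set n A b"
    and "mat_rank Xstar = r"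
    and "r + 1 \<le> s"
  defines "statement1 \<equiv> \<exists>X \<in> feasible_set n A b. mat_rank X \<ge> r + 1"
    and "statement2 \<equiv>
      \<exists>k \<le> s - r. \<exists>(\<Omega> :: nat \<Rightarrow> real mat) (x :: nat \<Rightarrow> 'm \<Rightarrow> real)
          (U :: nat \<Rightarrow> real mat) (W :: nat \<Rightarrow> real mat).
        U 0 = U0 \<and>
        (\<forall>j \<le> k.
           full_col_rank (W j) \<and>
           dim_row (W j) = dim_col (U j) \<and>
           mat_range (W j) = mat_kernel (compress (U j) (\<Omega> j)) \<and>
           U (Suc j) = U j * W j \<and>
           full_col_rank (U (Suc j))) \<and>
        (\<forall>j \<le> k. \<Omega> j \<noteq> 0\<^sub>m n n) \<and>
        (\<forall>j \<le> k. \<Omega> j = mat_lincomb n (x j) A) \<and>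
        (\<forall>j \<le> k. compress (U j) (\<Omega> j) \<in> psd_cone (dim_col (U j))) \<and>
        (\<forall>j \<le> k. mat_trace (Xstar * \<Omega> j) \<le> 0) \<and>
        (\<Sum>j\<le>k. mat_rank (compress (U j) (\<Omega> j))) = s - r"
  shows "(statement1 \<or> statement2) \<and> \<not> (statement1 \<and> statement2)"
proof -
  have A: "\<And>i. A i \<in> sym_mats n" using assms(1) by blast
  note U0 = assms(3) and fr = assms(4) and Xstar = assms(8) and rank = assms(9)
  \<comment> \<open>The conditions are quantified over \<open>j\<close> one by one in the theorem;
    here they are gathered under one quantifier.\<close>
  have statement2_iff: "statement2 \<longleftrightarrow> (\<exists>k \<le> s - r. \<exists>\<Omega> x U W. U 0 = U0 \<and>
      (\<forall>j\<le>k. reduction_step n A Xstar (\<Omega> j) (x j) (U j) (W j) (U (Suc j))) \<and>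
      (\<Sum>j\<le>k. mat_rank (compress (U j) (\<Omega> j))) = s - r)"
    unfolding statement2_def reduction_step_def
    by (simp only: all_conj_distrib imp_conjR conj_assoc)
  have fac: "\<exists>Y \<in> psd_cone s. X = U0 * Y * U0\<^sup>T" if "X \<in> feasible_set n A b" for X
    using min_face_factor[OF U0 fr] that assms(5) by (metis subsetD)
  have "statement2" if "\<not> statement1"
  proof -
    have max: "mat_rank X \<le> r" if "X \<in> feasible_set n A b" for X
      using \<open>\<not> statement1\<close> that unfolding statement1_def by force
    have "r < s" using assms(10) by simp
    from reduction_chain_exists[OF A Xstar rank max U0 fr this fac[OF Xstar]]
    obtain k \<Omega> x U W where "k < s - r" and chain: "U 0 = U0"
      "\<forall>j\<le>k. reduction_step n A Xstar (\<Omega> j) (x j) (U j) (W j) (U (Suc j))"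
      "(\<Sum>j\<le>k. mat_rank (compress (U j) (\<Omega> j))) = s - r" by blast
    then have "k \<le> s - r" by simp
    with chain show ?thesis unfolding statement2_iff by blast
  qed
  moreover have "\<not> statement1" if s2: "statement2"
  proof
    assume "statement1"
    then obtain X where X: "X \<in> feasible_set n A b" "r + 1 \<le> mat_rank X" unfolding statement1_def by blast
    obtain k \<Omega> x U W where U: "U 0 = U0" and chain: "\<forall>j\<le>k. reduction_step n A Xstar (\<Omega> j) (x j) (U j) (W j) (U (Suc j))"
      and sum: "(\<Sum>j\<le>k. mat_rank (compress (U j) (\<Omega> j))) = s - r"
      using s2 unfolding statement2_iff by blast
    have U0': "U 0 \<in> carrier_mat n s" using U U0 by simp
    obtain d Y where U': "U (Suc k) \<in> carrier_mat n d" and Y: "Y \<in> psd_cone d" "X = U (Suc k) * Y * (U (Suc k))\<^sup>T"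
      \<comment> \<open>At index \<open>Suc k\<close> all ranks have been used. They add up to
        \<open>s - r\<close>, so \<open>d = r\<close>, which contradicts a rank of at least
        \<open>r + 1\<close>.\<close>
      and d: "d + (\<Sum>i<Suc k. mat_rank (compress (U i) (\<Omega> i))) = s"
      using reduction_chain_factor[OF A U0' chain Xstar X(1) _ order.refl] fac[OF X(1)] U by auto
    have "mat_rank X \<le> d"
      unfolding Y(2) by (rule mat_rank_congruence_le[OF U' psd_cone_carrier[OF Y(1)]])
    then show False using X(2) d sum assms(10) by (simp add: lessThan_Suc_atMost)
  qed
  ultimately show ?thesis by blast
qed

end
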